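(* (Branching rule) Let $\alpha\vDash n$, $n\geq1$. Then, as $H_{n-1}(0)$-modules, \[\mathbf{S}_\alpha\downarrow^{H_n(0)}_{H_{n-1}(0)}\ \cong\ \bigoplus_{\alpha^-}\mathbf{S}_{\alpha^-},\] where the sum is over all compositions $\alpha^-$ obtained from $\alpha$ by the removal of a removable node.
   Context: A composition $\alpha=(\alpha_1,\ldots,\alpha_k)$ of $n$ ($\alpha\vDash n$) is an ordered list of positive integers summing to $n$. The reverse composition diagram of $\alpha$ is the array of left-justified cells with $\alpha_i$ cells in row $i$ from the top; $(i,j)$ is the cell in row $i$, column $j$. A part $\alpha_i$ has a removable node if either $i=1$, or $i\geq2$, $\alpha_i\geq2$ and there is no $1\leq j<i$ with $\alpha_j=\alpha_i-1$; the removable node is then the last cell $(i,\alpha_i)$ of row $i$. Removing it replaces $\alpha_i$ by $\alpha_i-1$ (and deletes the part if it becomes $0$, which can only happen for $i=1$). A standard reverse composition tableau (SRCT) of shape $\alpha\vDash n$ is a bijective filling $\tau:\alpha\to\{1,\ldots,n\}$ such that (1) rows decrease from left to right; (2) the first column increases from top to bottom; (3) (triple rule) if $i<j$ and $\tau(i,k)>\tau(j,k+1)$, then $\tau(i,k+1)$ exists and $\tau(i,k+1)>\tau(j,k+1)$. $\mathrm{Des}(\tau)=\{i\in[n-1]: i+1\text{ appears weakly right of } i\}$. Entries $i,i+1$ are attacking in $\tau$ if they are in the same column, or in adjacent columns with $i+1$ strictly southeast of $i$. For $1\leq i\leq n-1$, $\pi_i(\tau)=\tau$ if $i\notin\mathrm{Des}(\tau)$;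 $\pi_i(\tau)=0$ if $i\in\mathrm{Des}(\tau)$ and $i,i+1$ are attacking; $\pi_i(\tau)=s_i(\tau)$, the SRCT obtained by interchanging the positions of $i$ and $i+1$, if $i\in\mathrm{Des}(\tau)$ and $i,i+1$ are non-attacking. $H_n(0)$ is the $\mathbb{C}$-algebra generated by $T_1,\ldots,T_{n-1}$ with $T_i^2=T_i$, $T_iT_{i+1}T_i=T_{i+1}T_iT_{i+1}$, $T_iT_j=T_jT_i$ for $|i-j|\geq2$ (with $H_0(0)=H_1(0)=\mathbb{C}$). $\mathbf{S}_\alpha$ is the $H_n(0)$-module spanned over $\mathbb{C}$ by all SRCTs of shape $\alpha$, with $T_i$ acting as $\pi_i$ (for the empty composition it is $\mathbb{C}$). Here $H_{n-1}(0)$ is identified with the subalgebra $H_{1,n-1}(0)$ of $H_n(0)$ generated by $T_2,\ldots,T_{n-1}$, via $T_i\in H_{n-1}(0)\leftrightarrow T_{i+1}\in H_n(0)$, and $\downarrow$ denotes restriction to this subalgebra. *)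

theory Defs
  imports "HOL-Library.Poly_Mapping" "HOL-Algebra.QuotRing" "HOL-Algebra.Module"
    "HOL-Combinatorics.Transposition" Complex_Main
begin

section \<open>Compositions and reverse composition diagrams\<close>

definition composition_of :: "nat list \<Rightarrow> nat \<Rightarrow> bool"  (infix \<open>\<Turnstile>\<close> 50) where
  "\<alpha> \<Turnstile> n \<longleftrightarrow> (\<forall>a\<in>set \<alpha>. 0 < a) \<and> sum_list \<alpha> = n"

text \<open>Parts are numbered from 1, rows from top to bottom.\<close>

abbreviation part :: "nat list \<Rightarrow> nat \<Rightarrow> nat" where
  "part \<alpha> i \<equiv> \<alpha> ! (i - 1)"

definition diagram :: "nat list \<Rightarrow> (nat \<times> nat) set" where
  "diagram \<alpha> = {(i, j). 1 \<le> i \<and> i \<le> length \<alpha> \<and> 1 \<le> j \<and> j \<le> part \<alpha> i}"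

definition has_removable_node :: "nat list \<Rightarrow> nat \<Rightarrow> bool" where
  "has_removable_node \<alpha> i \<longleftrightarrow>
     1 \<le> i \<and> i \<le> length \<alpha> \<and>
     (i = 1 \<or>
      (2 \<le> i \<and> 2 \<le> part \<alpha> i \<and> \<not> (\<exists>j. 1 \<le> j \<and> j < i \<and> part \<alpha> j = part \<alpha> i - 1)))"

definition remove_node :: "nat list \<Rightarrow> nat \<Rightarrow> nat list" where
  "remove_node \<alpha> i = filter (\<lambda>a. a \<noteq> 0) (\<alpha>[i - 1 := part \<alpha> i - 1])"

definition node_removals :: "nat list \<Rightarrow> nat list set" where
  "node_removals \<alpha> = {remove_node \<alpha> i | i. has_removable_node \<alpha> i}"


section \<open>Standard reverse composition tableaux\<close>

text \<open>
  A filling takes the value 0 outside its diagram. As all entries of a tableau are positive,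
  distinct tableaux are then distinct functions, and the cells of a tableau can be read off
  from the function alone.
\<close>

type_synonym filling = "nat \<times> nat \<Rightarrow> nat"

definition srct :: "nat list \<Rightarrow> filling set" where
  "srct \<alpha> = {\<tau>.
     bij_betw \<tau> (diagram \<alpha>) {1..sum_list \<alpha>} \<and>
     (\<forall>c. c \<notin> diagram \<alpha> \<longrightarrow> \<tau> c = 0) \<and>
     (\<forall>i j j'. (i, j) \<in> diagram \<alpha> \<and> (i, j') \<in> diagram \<alpha> \<and> j < j' \<longrightarrow> \<tau> (i, j) > \<tau> (i, j')) \<and>
     (\<forall>i i'. (i, 1) \<in> diagram \<alpha> \<and> (i', 1) \<in> diagram \<alpha> \<and> i < i' \<longrightarrow> \<tau> (i, 1) < \<tau> (i', 1)) \<and>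
     (\<forall>i j k. i < j \<and> (i, k) \<in> diagram \<alpha> \<and> (j, k + 1) \<in> diagram \<alpha> \<and> \<tau> (i, k) > \<tau> (j, k + 1) \<longrightarrow>
        (i, k + 1) \<in> diagram \<alpha> \<and> \<tau> (i, k + 1) > \<tau> (j, k + 1))}"

text \<open>The condition \<open>1 \<le> i\<close> keeps the filler value 0 from being mistaken for an entry.\<close>

definition Des :: "filling \<Rightarrow> nat set" where
  "Des \<tau> = {i. 1 \<le> i \<and> (\<exists>r c r' c'. \<tau> (r, c) = i \<and> \<tau> (r', c') = i + 1 \<and> c \<le> c')}"

definition attacking :: "filling \<Rightarrow> nat \<Rightarrow> bool" where
  "attacking \<tau> i \<longleftrightarrow> 1 \<le> i \<and>
     (\<exists>r c r' c'. \<tau> (r, c) = i \<and> \<tau> (r', c') = i + 1 \<and>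
        (c = c' \<or> (c' = c + 1 \<and> r < r')))"

definition swap_entries :: "nat \<Rightarrow> filling \<Rightarrow> filling" where
  "swap_entries i \<tau> = transpose i (i + 1) \<circ> \<tau>"


section \<open>Formal complex linear combinations\<close>

definition scale :: "complex \<Rightarrow> ('b \<Rightarrow>\<^sub>0 complex) \<Rightarrow> ('b \<Rightarrow>\<^sub>0 complex)" where
  "scale c v = Poly_Mapping.map (\<lambda>x. c * x) v"

definition linear_extension ::
    "('a \<Rightarrow> ('b \<Rightarrow>\<^sub>0 complex)) \<Rightarrow> ('a \<Rightarrow>\<^sub>0 complex) \<Rightarrow> ('b \<Rightarrow>\<^sub>0 complex)" where
  "linear_extension g v = (\<Sum>x\<in>Poly_Mapping.keys v. scale (Poly_Mapping.lookup v x) (g x))"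

definition pi_op :: "nat \<Rightarrow> filling \<Rightarrow> (filling \<Rightarrow>\<^sub>0 complex)" where
  "pi_op i \<tau> =
     (if i \<notin> Des \<tau> then Poly_Mapping.single \<tau> 1
      else if attacking \<tau> i then 0
      else Poly_Mapping.single (swap_entries i \<tau>) 1)"


section \<open>The 0-Hecke algebra\<close>

text \<open>
  Words under concatenation form the free monoid; the finitely supported complex functions
  on words, with the convolution product of \<open>poly_mapping\<close>, are the free algebra.
\<close>

datatype word = Word (letters: "nat list")

instantiation word :: monoid_add
begin
definition zero_word :: word where "zero_word = Word []"
definition plus_word :: "word \<Rightarrow> word \<Rightarrow> word" where
  "plus_word u v = Word (letters u @ letters v)"
instance
  by standard (auto simp: zero_word_def plus_word_def)
end

type_synonym free_elt = "word \<Rightarrow>\<^sub>0 complex"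

definition gen :: "nat \<Rightarrow> free_elt" where
  "gen i = Poly_Mapping.single (Word [i]) 1"

text \<open>The free complex algebra on the letters \<open>1, \<dots>, n - 1\<close>.\<close>

definition free_algebra :: "nat \<Rightarrow> free_elt ring" where
  "free_algebra n =
     \<lparr>carrier = {f. \<forall>w\<in>Poly_Mapping.keys f. set (letters w) \<subseteq> {1..<n}},
      mult = (*), one = 1, zero = 0, add = (+)\<rparr>"

definition hecke_relators :: "nat \<Rightarrow> free_elt set" where
  "hecke_relators n =
     {gen i * gen i - gen i | i. i \<in> {1..<n}} \<union>
     {gen i * gen (i + 1) * gen i - gen (i + 1) * gen i * gen (i + 1) | i.
        i \<in> {1..<n} \<and> i + 1 \<in> {1..<n}} \<union>
     {gen i * gen j - gen j * gen i | i j.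
        i \<in> {1..<n} \<and> j \<in> {1..<n} \<and> \<bar>int i - int j\<bar> \<ge> 2}"

definition hecke_ideal :: "nat \<Rightarrow> free_elt set" where
  "hecke_ideal n = Idl\<^bsub>free_algebra n\<^esub> (hecke_relators n)"

text \<open>
  The scalars of this algebra are the classes of the multiples of 1. A module over it as a ring
  is therefore a complex vector space, and its module homomorphisms are complex linear.
\<close>

definition hecke0 :: "nat \<Rightarrow> free_elt set ring" where
  "hecke0 n = free_algebra n Quot hecke_ideal n"

text \<open>
  The map from \<open>hecke0 (n - 1)\<close> to \<open>hecke0 n\<close> that sends the
  class of \<open>gen i\<close> to the class of \<open>gen (i + 1)\<close>. The image of a coset is the coset containing
  all shifts of its elements. The map is injective, because sending the first generator to 0 and
  every other \<open>gen (i + 1)\<close> to \<open>gen i\<close> respects the relations and gives a left inverse. Its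
  image is the subalgebra generated by the classes of \<open>gen 2, \<dots>, gen (n - 1)\<close>.
\<close>

definition shift_letters :: "free_elt \<Rightarrow> free_elt" where
  "shift_letters =
     linear_extension (\<lambda>w. Poly_Mapping.single (Word (map Suc (letters w))) 1)"

definition hecke_embedding :: "nat \<Rightarrow> free_elt set \<Rightarrow> free_elt set" where
  "hecke_embedding n X = hecke_ideal n <+>\<^bsub>free_algebra n\<^esub> shift_letters ` X"


section \<open>Left modules\<close>

text \<open>
  The locale \<^locale>\<open>module\<close> is about commutative rings only; its record type is reused here. The
  ring multiplication and unit of such a record play no role for modules.
\<close>

locale left_module = R?: ring R + M?: abelian_group M
    for R (structure) and M (structure) +
  assumes smult_closed:
      "\<lbrakk>a \<in> carrier R; x \<in> carrier M\<rbrakk> \<Longrightarrow> a \<odot>\<^bsub>M\<^esub> x \<in> carrier M"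
    and smult_l_distr:
      "\<lbrakk>a \<in> carrier R; b \<in> carrier R; x \<in> carrier M\<rbrakk> \<Longrightarrow>
       (a \<oplus>\<^bsub>R\<^esub> b) \<odot>\<^bsub>M\<^esub> x = (a \<odot>\<^bsub>M\<^esub> x) \<oplus>\<^bsub>M\<^esub> (b \<odot>\<^bsub>M\<^esub> x)"
    and smult_r_distr:
      "\<lbrakk>a \<in> carrier R; x \<in> carrier M; y \<in> carrier M\<rbrakk> \<Longrightarrow>
       a \<odot>\<^bsub>M\<^esub> (x \<oplus>\<^bsub>M\<^esub> y) = (a \<odot>\<^bsub>M\<^esub> x) \<oplus>\<^bsub>M\<^esub> (a \<odot>\<^bsub>M\<^esub> y)"
    and smult_assoc:
      "\<lbrakk>a \<in> carrier R; b \<in> carrier R; x \<in> carrier M\<rbrakk> \<Longrightarrow>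
       (a \<otimes>\<^bsub>R\<^esub> b) \<odot>\<^bsub>M\<^esub> x = a \<odot>\<^bsub>M\<^esub> (b \<odot>\<^bsub>M\<^esub> x)"
    and smult_one:
      "x \<in> carrier M \<Longrightarrow> \<one>\<^bsub>R\<^esub> \<odot>\<^bsub>M\<^esub> x = x"

definition module_hom ::
    "('r, 'p) ring_scheme \<Rightarrow> ('r, 'a) module \<Rightarrow> ('r, 'b) module \<Rightarrow> ('a \<Rightarrow> 'b) set" where
  "module_hom R M N =
     {\<phi> \<in> carrier M \<rightarrow> carrier N.
        (\<forall>x\<in>carrier M. \<forall>y\<in>carrier M. \<phi> (x \<oplus>\<^bsub>M\<^esub> y) = \<phi> x \<oplus>\<^bsub>N\<^esub> \<phi> y) \<and>
        (\<forall>a\<in>carrier R. \<forall>x\<in>carrier M. \<phi> (a \<odot>\<^bsub>M\<^esub> x) = a \<odot>\<^bsub>N\<^esub> \<phi> x)}"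

definition isomorphic_modules ::
    "('r, 'p) ring_scheme \<Rightarrow> ('r, 'a) module \<Rightarrow> ('r, 'b) module \<Rightarrow> bool" where
  "isomorphic_modules R M N \<longleftrightarrow>
     left_module R M \<and> left_module R N \<and>
     (\<exists>\<phi>\<in>module_hom R M N. bij_betw \<phi> (carrier M) (carrier N))"

text \<open>Restriction of scalars along a ring homomorphism \<open>h\<close>.\<close>

definition restrict_scalars :: "('s \<Rightarrow> 'r) \<Rightarrow> ('r, 'a) module \<Rightarrow> ('s, 'a) module" where
  "restrict_scalars h M =
     \<lparr>carrier = carrier M, mult = mult M, one = one M, zero = zero M, add = add M,
      smult = (\<lambda>a x. h a \<odot>\<^bsub>M\<^esub> x)\<rparr>"

definition direct_sum :: "'i set \<Rightarrow> ('i \<Rightarrow> ('r, 'a) module) \<Rightarrow> ('r, 'i \<Rightarrow> 'a) module" where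
  "direct_sum I M =
     \<lparr>carrier = {f \<in> \<Pi>\<^sub>E i\<in>I. carrier (M i). finite {i\<in>I. f i \<noteq> \<zero>\<^bsub>M i\<^esub>}},
      mult = undefined, one = undefined,
      zero = (\<lambda>i\<in>I. \<zero>\<^bsub>M i\<^esub>),
      add = (\<lambda>f g. \<lambda>i\<in>I. f i \<oplus>\<^bsub>M i\<^esub> g i),
      smult = (\<lambda>a f. \<lambda>i\<in>I. a \<odot>\<^bsub>M i\<^esub> f i)\<rparr>"


section \<open>The modules spanned by tableaux\<close>

definition word_action :: "word \<Rightarrow> (filling \<Rightarrow>\<^sub>0 complex) \<Rightarrow> (filling \<Rightarrow>\<^sub>0 complex)" where
  "word_action w v = foldr (\<lambda>i. linear_extension (pi_op i)) (letters w) v"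

definition free_action :: "free_elt \<Rightarrow> (filling \<Rightarrow>\<^sub>0 complex) \<Rightarrow> (filling \<Rightarrow>\<^sub>0 complex)" where
  "free_action f v = linear_extension (\<lambda>w. word_action w v) f"

text \<open>
  A class acts through any of its representatives: \<^const>\<open>the_elem\<close> picks the common value.
  For \<open>\<alpha> = []\<close> the only tableau is the zero function, and the module is one-dimensional.
\<close>

definition srct_module ::
    "nat list \<Rightarrow> (free_elt set, filling \<Rightarrow>\<^sub>0 complex) module"  (\<open>\<^bold>S\<close>) where
  "\<^bold>S \<alpha> =
     \<lparr>carrier = {v. Poly_Mapping.keys v \<subseteq> srct \<alpha>},
      mult = undefined, one = undefined, zero = 0, add = (+),
      smult = (\<lambda>X v. the_elem ((\<lambda>f. free_action f v) ` X))\<rparr>"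

end

(*
The entry 1 of a tableau sits at the end of its row, and the triple rule says exactly that its cell
is a removable node. Deleting it and lowering the other entries by 1 is a bijection from the
tableaux of shape alpha to the disjoint union of the tableaux of the shapes obtained by removing a
removable node, and it turns pi_(i+1) into pi_i. Its linear extension, split by shape, is the
isomorphism. That the target is a module at all comes down to the 0-Hecke relations for the pi_i.
*)

theory Submission
  imports Defs
begin

section \<open>Linear maps between spaces of formal linear combinations\<close>

text \<open>An operator looks only at the cells of two consecutive entries, so the Hecke relations
  are checked for any filling whose nonzero entries are distinct and which contains the entries
  concerned. For the Hecke action, the conditions on rows, first column and triples enter through
  the stability of the span of one shape. In the restricted module a coset acts through
  \<open>the_elem\<close>, so all its elements have to act alike. Here the map to the direct sum
  comes before the module structure: it turns shifted elements of the free algebra into unshifted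
  ones, and being injective it reflects equalities of actions. The action of an embedded coset and
  the module axioms of the restriction are both pulled back from the direct sum. A node alone in its
  row is removable only in the first row. Deleting it moves all other rows up by one; descents and
  attacks see columns and the relative order of rows, which do not change. As fillings vanish
  outside their diagrams, a stripped tableau knows its shape, and distinct nodes leave distinct
  shapes.\<close>

lemma lookup_scale [simp]: "Poly_Mapping.lookup (scale c v) x = c * Poly_Mapping.lookup v x"
  by (simp add: scale_def Poly_Mapping.map.rep_eq when_def)

lemma scale_add_right: "scale c (u + v) = scale c u + scale c v"
  by (rule poly_mapping_eqI) (simp add: lookup_add algebra_simps)

lemma scale_add_left: "scale (c + d) v = scale c v + scale d v"
  by (rule poly_mapping_eqI) (simp add: lookup_add algebra_simps)

lemma scale_scale [simp]: "scale c (scale d v) = scale (c * d) v"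
  by (rule poly_mapping_eqI) (simp add: algebra_simps)

lemma scale_zero_left [simp]: "scale 0 v = 0"
  by (rule poly_mapping_eqI) simp

lemma scale_zero_right [simp]: "scale c 0 = 0"
  by (rule poly_mapping_eqI) simp

lemma scale_one [simp]: "scale 1 v = v"
  by (rule poly_mapping_eqI) simp

lemma scale_sum: "scale c (sum f A) = (\<Sum>x\<in>A. scale c (f x))"
  by (induction A rule: infinite_finite_induct) (auto simp: scale_add_right)

lemma scale_single [simp]: "scale c (Poly_Mapping.single x d) = Poly_Mapping.single x (c * d)"
  by (rule poly_mapping_eqI) (simp add: lookup_single when_def)

lemma keys_scale: "Poly_Mapping.keys (scale c v) \<subseteq> Poly_Mapping.keys v"
  by (auto simp: in_keys_iff)

definition complex_linear :: "(('a \<Rightarrow>\<^sub>0 complex) \<Rightarrow> ('b \<Rightarrow>\<^sub>0 complex)) \<Rightarrow> bool" where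
  "complex_linear f \<longleftrightarrow> (\<forall>u v. f (u + v) = f u + f v) \<and> (\<forall>c v. f (scale c v) = scale c (f v))"

lemma complex_linearI:
  "\<lbrakk>\<And>u v. f (u + v) = f u + f v; \<And>c v. f (scale c v) = scale c (f v)\<rbrakk> \<Longrightarrow> complex_linear f"
  by (simp add: complex_linear_def)

lemma complex_linear_add: "complex_linear f \<Longrightarrow> f (u + v) = f u + f v"
  by (simp add: complex_linear_def)

lemma complex_linear_scale: "complex_linear f \<Longrightarrow> f (scale c v) = scale c (f v)"
  by (simp add: complex_linear_def)

lemma complex_linear_zero: "complex_linear f \<Longrightarrow> f 0 = 0"
  using complex_linear_scale[of f 0 0] by simp

lemma complex_linear_diff: "complex_linear f \<Longrightarrow> f (u - v) = f u - f v"
  using complex_linear_add[of f "u - v" v] by (simp add: algebra_simps)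

lemma complex_linear_sum: "complex_linear f \<Longrightarrow> f (sum g A) = (\<Sum>x\<in>A. f (g x))"
  by (induction A rule: infinite_finite_induct) (auto simp: complex_linear_add complex_linear_zero)

lemma complex_linear_comp: "\<lbrakk>complex_linear f; complex_linear g\<rbrakk> \<Longrightarrow> complex_linear (\<lambda>v. f (g v))"
  by (simp add: complex_linear_def)

lemma complex_linear_id: "complex_linear (\<lambda>v. v)"
  by (simp add: complex_linear_def)

text \<open>The supports of \<open>u\<close>, \<open>v\<close> and \<open>u + v\<close> differ, as
  coefficients may cancel. Summing over one common finite set makes the three sums
  comparable.\<close>

lemma linear_extension_superset:
  assumes "finite A" "Poly_Mapping.keys v \<subseteq> A"
  shows "linear_extension g v = (\<Sum>x\<in>A. scale (Poly_Mapping.lookup v x) (g x))"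
  unfolding linear_extension_def
  by (rule sum.mono_neutral_left) (use assms in \<open>auto simp: in_keys_iff\<close>)

lemma complex_linear_linear_extension: "complex_linear (linear_extension g)"
proof (rule complex_linearI)
  fix u v :: "'a \<Rightarrow>\<^sub>0 complex"
  let ?A = "Poly_Mapping.keys u \<union> Poly_Mapping.keys v"
  have "linear_extension g w = (\<Sum>x\<in>?A. scale (Poly_Mapping.lookup w x) (g x))"
    if "w \<in> {u, v, u + v}" for w
    using that Poly_Mapping.keys_add[of u v] by (intro linear_extension_superset) auto
  then show "linear_extension g (u + v) = linear_extension g u + linear_extension g v"
    by (simp add: lookup_add scale_add_left sum.distrib)
next
  fix c and v :: "'a \<Rightarrow>\<^sub>0 complex"
  show "linear_extension g (scale c v) = scale c (linear_extension g v)"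
    by (subst linear_extension_superset[OF _ keys_scale])
      (auto simp: linear_extension_def scale_sum)
qed

lemma linear_extension_single [simp]:
  "linear_extension g (Poly_Mapping.single x c) = scale c (g x)"
  by (simp add: linear_extension_def)

lemma linear_extension_id: "linear_extension (\<lambda>x. Poly_Mapping.single x 1) v = v"
proof (rule poly_mapping_eqI)
  fix y
  have "Poly_Mapping.lookup (sum f A) y = (\<Sum>x\<in>A. Poly_Mapping.lookup (f x) y)"
    for f :: "'a \<Rightarrow> 'a \<Rightarrow>\<^sub>0 complex" and A
    by (induction A rule: infinite_finite_induct) (auto simp: lookup_add)
  then show "Poly_Mapping.lookup (linear_extension (\<lambda>x. Poly_Mapping.single x 1) v) y =
      Poly_Mapping.lookup v y"
    by (simp add: linear_extension_def lookup_single when_def in_keys_iff)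
qed

lemma complex_linear_expand:
  assumes "complex_linear f"
  shows "f v = linear_extension (\<lambda>x. f (Poly_Mapping.single x 1)) v"
proof -
  have "f v = f (linear_extension (\<lambda>x. Poly_Mapping.single x 1) v)"
    by (simp only: linear_extension_id)
  then show ?thesis
    unfolding linear_extension_def by (simp only: complex_linear_sum[OF assms] complex_linear_scale[OF assms])
qed

lemma linear_extension_cong:
  "\<lbrakk>\<And>x. x \<in> Poly_Mapping.keys v \<Longrightarrow> g x = h x\<rbrakk> \<Longrightarrow> linear_extension g v = linear_extension h v"
  by (simp add: linear_extension_def)

text \<open>Linear maps live on all formal combinations, but most identities below hold only on the
  span of certain fillings. The set \<open>A\<close> is the basis of that span.\<close>

lemma complex_linear_eqI:
  assumes "complex_linear f" "complex_linear g" "Poly_Mapping.keys v \<subseteq> A"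
    and "\<And>x. x \<in> A \<Longrightarrow> f (Poly_Mapping.single x 1) = g (Poly_Mapping.single x 1)"
  shows "f v = g v"
proof -
  have "linear_extension (\<lambda>x. f (Poly_Mapping.single x 1)) v =
      linear_extension (\<lambda>x. g (Poly_Mapping.single x 1)) v"
    by (rule linear_extension_cong) (use assms(3,4) in auto)
  then show ?thesis
    by (simp only: complex_linear_expand[OF assms(1), symmetric]
        complex_linear_expand[OF assms(2), symmetric])
qed

lemma keys_sum_subset:
  "(\<And>x. x \<in> A \<Longrightarrow> Poly_Mapping.keys (f x) \<subseteq> B) \<Longrightarrow> Poly_Mapping.keys (sum f A) \<subseteq> B"
proof (induction A rule: infinite_finite_induct)
  case (insert x A)
  then have "Poly_Mapping.keys (f x) \<union> Poly_Mapping.keys (sum f A) \<subseteq> B" by simp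
  then show ?case
    using insert.hyps Poly_Mapping.keys_add[of "f x" "sum f A"] by (simp add: subset_trans)
qed auto

lemma keys_linear_extension:
  assumes "\<And>x. x \<in> Poly_Mapping.keys v \<Longrightarrow> Poly_Mapping.keys (g x) \<subseteq> B"
  shows "Poly_Mapping.keys (linear_extension g v) \<subseteq> B"
  unfolding linear_extension_def
  by (rule keys_sum_subset) (rule order_trans[OF keys_scale assms])

lemma linear_extension_add_fun:
  "linear_extension (\<lambda>x. g x + h x) v = linear_extension g v + linear_extension h v"
  by (simp add: linear_extension_def scale_add_right sum.distrib)

lemma linear_extension_scale_fun:
  "linear_extension (\<lambda>x. scale c (g x)) v = scale c (linear_extension g v)"
  by (simp add: linear_extension_def scale_sum mult.commute)


section \<open>The action of the free algebra\<close>

lemma complex_linear_word_action: "complex_linear (word_action w)"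
proof -
  have "complex_linear (\<lambda>v. foldr (\<lambda>i. linear_extension (pi_op i)) ws v)" for ws
    by (induction ws) (simp_all add: complex_linear_id complex_linear_comp[OF complex_linear_linear_extension])
  then show ?thesis by (simp add: word_action_def[abs_def])
qed

lemma word_action_add: "word_action (w + w') v = word_action w (word_action w' v)"
  by (simp add: word_action_def plus_word_def)

lemma complex_linear_free_action_left: "complex_linear (\<lambda>f. free_action f v)"
  unfolding free_action_def by (rule complex_linear_linear_extension)

lemma complex_linear_free_action_right: "complex_linear (free_action f)"
  by (rule complex_linearI) (simp_all add: free_action_def complex_linear_add[OF complex_linear_word_action]
      complex_linear_scale[OF complex_linear_word_action] linear_extension_add_fun linear_extension_scale_fun)

lemmas free_action_linear =
  complex_linear_add[OF complex_linear_free_action_left] complex_linear_scale[OF complex_linear_free_action_left]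
  complex_linear_add[OF complex_linear_free_action_right] complex_linear_scale[OF complex_linear_free_action_right]

lemma free_action_single [simp]:
  "free_action (Poly_Mapping.single w 1) v = word_action w v"
  by (simp add: free_action_def)

text \<open>The zero of \<open>word\<close> is the empty word, so
  \<open>Poly_Mapping.single 0 c\<close> is the scalar c inside the free algebra. With its
  right-hand counterpart this makes the convolution product bilinear.\<close>

lemma scale_conv_mult_left: "scale c (f :: free_elt) = Poly_Mapping.single 0 c * f"
proof (rule poly_mapping_eqI)
  fix w :: word
  have eq: "Poly_Mapping.lookup (Poly_Mapping.single 0 c) l *
      Sum_any (\<lambda>q. Poly_Mapping.lookup f q when w = l + q) =
      (c * Poly_Mapping.lookup f w when l = 0)" for l
    by (cases "l = 0") (simp_all add: lookup_single)
  show "Poly_Mapping.lookup (scale c f) w = Poly_Mapping.lookup (Poly_Mapping.single 0 c * f) w"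
    by (simp only: lookup_mult eq) simp
qed

lemma scale_conv_mult_right: "scale c (f :: free_elt) = f * Poly_Mapping.single 0 c"
proof (rule poly_mapping_eqI)
  fix w :: word
  \<comment> \<open>Only the empty word contributes to the inner sum, and \<open>w = l + 0\<close>
    then pins down \<open>l\<close>.\<close>
  have "(\<lambda>q. Poly_Mapping.lookup (Poly_Mapping.single 0 c) q when w = l + q) =
      (\<lambda>q. (c when l = w) when q = 0)" for l :: word
    by (auto simp: when_def lookup_single fun_eq_iff)
  then have eq: "Sum_any (\<lambda>q. Poly_Mapping.lookup (Poly_Mapping.single 0 c) q when w = l + q) =
      (c when l = w)" for l :: word
    by (simp only:) simp
  show "Poly_Mapping.lookup (scale c f) w =
      Poly_Mapping.lookup (f * Poly_Mapping.single 0 c) w"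
    by (simp only: lookup_mult eq) (simp add: mult_when mult.commute)
qed

lemma scale_mult_left: "scale c (f :: free_elt) * g = scale c (f * g)"
  by (simp add: scale_conv_mult_left mult.assoc)

lemma scale_mult_right: "(f :: free_elt) * scale c g = scale c (f * g)"
  using scale_conv_mult_right[of c g] scale_conv_mult_right[of c "f * g"] by (simp add: mult.assoc)

text \<open>Both sides are linear in \<open>f\<close> and in \<open>g\<close>. Two basis words
  remain, and for them concatenation is composition of operators.\<close>

lemma free_action_mult: "free_action (f * g) v = free_action f (free_action g v)"
proof (rule complex_linear_eqI[where A=UNIV and v=f])
  show "complex_linear (\<lambda>f. free_action (f * g) v)"
    by (rule complex_linearI) (simp_all only: distrib_right scale_mult_left free_action_linear)
  show "complex_linear (\<lambda>f. free_action f (free_action g v))"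
    by (rule complex_linear_free_action_left)
  fix w
  show "free_action (Poly_Mapping.single w 1 * g) v =
      free_action (Poly_Mapping.single w 1) (free_action g v)"
  proof (rule complex_linear_eqI[where A=UNIV and v=g])
    show "complex_linear (\<lambda>g. free_action (Poly_Mapping.single w 1 * g) v)"
      by (rule complex_linearI) (simp_all only: distrib_left scale_mult_right free_action_linear)
    show "complex_linear (\<lambda>g. free_action (Poly_Mapping.single w 1) (free_action g v))"
      by (rule complex_linear_comp[OF complex_linear_free_action_right complex_linear_free_action_left])
  qed (simp_all add: mult_single word_action_add)
qed simp

lemma free_action_one [simp]: "free_action 1 v = v"
proof -
  have "(1 :: free_elt) = Poly_Mapping.single (Word []) 1"
    by (simp add: single_one[symmetric] zero_word_def del: single_one)
  then have "free_action 1 v = word_action (Word []) v" by (metis free_action_single)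
  then show ?thesis by (simp add: word_action_def)
qed

lemma free_action_gen [simp]: "free_action (gen i) v = linear_extension (pi_op i) v"
  by (simp add: gen_def word_action_def)


section \<open>The operators on tableaux\<close>

text \<open>All cells outside a diagram share the value 0, so injectivity can be asked of nonzero
  values only.\<close>

definition inj_entries :: "filling \<Rightarrow> bool" where
  "inj_entries \<tau> \<longleftrightarrow> (\<forall>c c'. \<tau> c = \<tau> c' \<longrightarrow> \<tau> c \<noteq> 0 \<longrightarrow> c = c')"

text \<open>Here \<open>p\<close> is the cell of i and \<open>q\<close> that of i + 1; the relation
  is not symmetric.\<close>

definition attack :: "nat \<times> nat \<Rightarrow> nat \<times> nat \<Rightarrow> bool" where
  "attack p q \<longleftrightarrow> snd p = snd q \<or> (snd q = snd p + 1 \<and> fst p < fst q)"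

abbreviation pi_lin :: "nat \<Rightarrow> (filling \<Rightarrow>\<^sub>0 complex) \<Rightarrow> (filling \<Rightarrow>\<^sub>0 complex)" where
  "pi_lin i \<equiv> linear_extension (pi_op i)"

lemma inj_entries_unique: "\<lbrakk>inj_entries \<tau>; \<tau> p = x; \<tau> c = x; 0 < x\<rbrakk> \<Longrightarrow> c = p"
  unfolding inj_entries_def by (metis less_numeral_extra(3))

lemma Des_iff:
  assumes "inj_entries \<tau>" "\<tau> p = i" "\<tau> q = Suc i" "1 \<le> i"
  shows "i \<in> Des \<tau> \<longleftrightarrow> snd p \<le> snd q"
proof
  assume "i \<in> Des \<tau>"
  then obtain r c r' c' where "\<tau> (r, c) = i" "\<tau> (r', c') = Suc i" "c \<le> c'"
    by (auto simp: Des_def)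
  moreover from this have "(r, c) = p" "(r', c') = q"
    using assms inj_entries_unique by auto
  ultimately show "snd p \<le> snd q" by auto
qed (use assms in \<open>cases p; cases q; auto simp: Des_def\<close>)

lemma attacking_iff:
  assumes "inj_entries \<tau>" "\<tau> p = i" "\<tau> q = Suc i" "1 \<le> i"
  shows "attacking \<tau> i \<longleftrightarrow> attack p q"
proof
  assume "attacking \<tau> i"
  then obtain r c r' c' where "\<tau> (r, c) = i" "\<tau> (r', c') = Suc i"
    "c = c' \<or> (c' = c + 1 \<and> r < r')"
    by (auto simp: attacking_def)
  moreover from this have "(r, c) = p" "(r', c') = q"
    using assms inj_entries_unique by auto
  ultimately show "attack p q" by (auto simp: attack_def)
qed (use assms in \<open>cases p; cases q; fastforce simp: attacking_def attack_def\<close>)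

text \<open>Distinct entries have one cell each, so the existential quantifiers in
  \<open>Des\<close> and \<open>attacking\<close> disappear, and the Hecke relations become case
  distinctions on the positions of a few cells.\<close>

lemma pi_op_cells:
  assumes "inj_entries \<tau>" "\<tau> p = i" "\<tau> q = Suc i" "1 \<le> i"
  shows "pi_op i \<tau> =
    (if snd q < snd p then Poly_Mapping.single \<tau> 1
     else if attack p q then 0 else Poly_Mapping.single (swap_entries i \<tau>) 1)"
  using Des_iff[OF assms] attacking_iff[OF assms] by (auto simp: pi_op_def)

lemma swap_entries_apply:
  "swap_entries i \<tau> c = (if \<tau> c = i then Suc i else if \<tau> c = Suc i then i else \<tau> c)"
  by (simp add: swap_entries_def transpose_def)

lemma inj_entries_swap:
  assumes "inj_entries \<tau>" "1 \<le> i"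
  shows "inj_entries (swap_entries i \<tau>)"
proof -
  have "\<tau> c = \<tau> c'" "\<tau> c \<noteq> 0"
    if "swap_entries i \<tau> c = swap_entries i \<tau> c'" "swap_entries i \<tau> c \<noteq> 0" for c c'
    using that \<open>1 \<le> i\<close> by (auto simp: swap_entries_apply split: if_splits)
  then show ?thesis using assms(1) unfolding inj_entries_def by blast
qed

lemma swap_entries_braid:
  "swap_entries i (swap_entries (Suc i) (swap_entries i \<tau>)) =
   swap_entries (Suc i) (swap_entries i (swap_entries (Suc i) \<tau>))"
  by (auto simp: fun_eq_iff swap_entries_apply)

lemma swap_entries_commute:
  "\<bar>int i - int j\<bar> \<ge> 2 \<Longrightarrow>
    swap_entries i (swap_entries j \<tau>) = swap_entries j (swap_entries i \<tau>)"
  by (auto simp: fun_eq_iff swap_entries_apply)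

text \<open>Entries in one column attack, so an exchange happens only when i stands strictly left of
  i + 1. Afterwards it stands strictly right of it, and the operator fixes the result.\<close>

lemma pi_idem:
  assumes "inj_entries \<tau>" "\<tau> p = i" "\<tau> q = Suc i" "1 \<le> i"
  shows "pi_lin i (pi_lin i (Poly_Mapping.single \<tau> 1)) = pi_lin i (Poly_Mapping.single \<tau> 1)"
proof -
  have "pi_op i (swap_entries i \<tau>) =
    (if snd p < snd q then Poly_Mapping.single (swap_entries i \<tau>) 1
     else if attack q p then 0
     else Poly_Mapping.single (swap_entries i (swap_entries i \<tau>)) 1)"
    by (rule pi_op_cells) (use assms inj_entries_swap in \<open>auto simp: swap_entries_apply\<close>)
  with pi_op_cells[OF assms] show ?thesis
    by (auto simp: complex_linear_zero[OF complex_linear_linear_extension] attack_def)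
qed

text \<open>The pairs {i, i + 1} and {j, j + 1} are disjoint, so exchanging one pair leaves the
  cells of the other in place and does not affect which case of its operator applies.\<close>

lemma pi_commute:
  assumes "inj_entries \<tau>" "\<tau> p = i" "\<tau> q = Suc i" "\<tau> r = j" "\<tau> s = Suc j"
    and "1 \<le> i" "1 \<le> j" and far: "\<bar>int i - int j\<bar> \<ge> 2"
  shows "pi_lin i (pi_lin j (Poly_Mapping.single \<tau> 1)) =
         pi_lin j (pi_lin i (Poly_Mapping.single \<tau> 1))"
proof -
  note e = pi_op_cells[of "\<tau>" p i q] pi_op_cells[of "\<tau>" r j s]
  have 1: "pi_op i (swap_entries j \<tau>) =
    (if snd q < snd p then Poly_Mapping.single (swap_entries j \<tau>) 1
     else if attack p q then 0
     else Poly_Mapping.single (swap_entries i (swap_entries j \<tau>)) 1)"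
    by (rule pi_op_cells) (use assms inj_entries_swap in \<open>auto simp: swap_entries_apply\<close>)
  have 2: "pi_op j (swap_entries i \<tau>) =
    (if snd s < snd r then Poly_Mapping.single (swap_entries i \<tau>) 1
     else if attack r s then 0
     else Poly_Mapping.single (swap_entries j (swap_entries i \<tau>)) 1)"
    by (rule pi_op_cells) (use assms inj_entries_swap in \<open>auto simp: swap_entries_apply\<close>)
  show ?thesis
    using assms e 1 2 swap_entries_commute[OF far, of \<tau>]
    by (simp add: complex_linear_zero[OF complex_linear_linear_extension])
qed

definition three_cells ::
    "nat \<Rightarrow> filling \<Rightarrow> nat \<times> nat \<Rightarrow> nat \<times> nat \<Rightarrow> nat \<times> nat \<Rightarrow> bool" where
  "three_cells i \<tau> p q r \<longleftrightarrow>
     inj_entries \<tau> \<and> \<tau> p = i \<and> \<tau> q = Suc i \<and> \<tau> r = Suc (Suc i) \<and> 1 \<le> i"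

text \<open>The cells are listed by increasing entry, so exchanging two consecutive entries
  transposes two neighbours in the list.\<close>

lemma three_cells_swap:
  "three_cells i \<tau> p q r \<Longrightarrow> three_cells i (swap_entries i \<tau>) q p r"
  "three_cells i \<tau> p q r \<Longrightarrow> three_cells i (swap_entries (Suc i) \<tau>) p r q"
  by (auto simp: three_cells_def inj_entries_swap swap_entries_apply)

lemma pi_op_three_cells:
  assumes "three_cells i \<tau> p q r"
  shows "pi_op i \<tau> =
    (if snd q < snd p then Poly_Mapping.single \<tau> 1
     else if attack p q then 0 else Poly_Mapping.single (swap_entries i \<tau>) 1)"
    and "pi_op (Suc i) \<tau> =
    (if snd r < snd q then Poly_Mapping.single \<tau> 1
     else if attack q r then 0 else Poly_Mapping.single (swap_entries (Suc i) \<tau>) 1)"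
  by (rule pi_op_cells; use assms in \<open>auto simp: three_cells_def\<close>)+

text \<open>
  The operator with index \<open>i\<close> only looks at the cells of \<open>i\<close> and \<open>i + 1\<close>, and it fixes a tableau
  in which it has just exchanged them. So the braid relation is a statement about three cells.
\<close>

lemma pi_braid:
  assumes "three_cells i \<tau> p q r"
  shows "pi_lin i (pi_lin (Suc i) (pi_lin i (Poly_Mapping.single \<tau> 1))) =
         pi_lin (Suc i) (pi_lin i (pi_lin (Suc i) (Poly_Mapping.single \<tau> 1)))"
proof -
  let ?a = "swap_entries i" and ?b = "swap_entries (Suc i)"
  note a = three_cells_swap(1) and b = three_cells_swap(2)
  note e = pi_op_three_cells[OF assms] pi_op_three_cells[OF a[OF assms]]
    pi_op_three_cells[OF b[OF assms]] pi_op_three_cells[OF b[OF a[OF assms]]]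
    pi_op_three_cells[OF a[OF b[OF assms]]]
  \<comment> \<open>The three alternatives for a pair are: fixed, sent to 0, exchanged. In the last
    one the columns differ strictly, since cells of one column attack; this is what shows that a
    pair just exchanged is fixed.\<close>
  have "snd q < snd p \<or> snd p \<le> snd q \<and> attack p q \<or> snd p < snd q \<and> \<not> attack p q"
    by (auto simp: attack_def)
  moreover have "snd r < snd q \<or> snd q \<le> snd r \<and> attack q r \<or> snd q < snd r \<and> \<not> attack q r"
    by (auto simp: attack_def)
  moreover have "snd r < snd p \<or> snd p \<le> snd r \<and> attack p r \<or> snd p < snd r \<and> \<not> attack p r"
    by (auto simp: attack_def)
  ultimately show ?thesis
    by (elim disjE conjE; simp add: e complex_linear_zero[OF complex_linear_linear_extension] swap_entries_braid)
qed


section \<open>The tableau conditions one by one, and stability of the span of one shape\<close>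

lemma srct_bij: "\<tau> \<in> srct \<alpha> \<Longrightarrow> bij_betw \<tau> (diagram \<alpha>) {1..sum_list \<alpha>}"
  unfolding srct_def mem_Collect_eq by (elim conjE)

lemma srct_zero_iff:
  assumes "\<tau> \<in> srct \<alpha>"
  shows "\<tau> c = 0 \<longleftrightarrow> c \<notin> diagram \<alpha>"
proof (cases "c \<in> diagram \<alpha>")
  case True
  then have "\<tau> c \<in> {1..sum_list \<alpha>}"
    using srct_bij[OF assms] by (rule bij_betwE[rule_format, rotated])
  with True show ?thesis by simp
next
  case False
  moreover have "\<forall>c. c \<notin> diagram \<alpha> \<longrightarrow> \<tau> c = 0"
    using assms unfolding srct_def mem_Collect_eq by (elim conjE)
  ultimately show ?thesis by (iprover intro: iffI)
qed

lemma srct_row_decreasing: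
  assumes "\<tau> \<in> srct \<alpha>" "(i, j) \<in> diagram \<alpha>" "(i, j') \<in> diagram \<alpha>" "j < j'"
  shows "\<tau> (i, j') < \<tau> (i, j)"
proof -
  have "\<forall>i j j'. (i, j) \<in> diagram \<alpha> \<and> (i, j') \<in> diagram \<alpha> \<and> j < j' \<longrightarrow> \<tau> (i, j) > \<tau> (i, j')"
    using assms(1) unfolding srct_def mem_Collect_eq by (elim conjE)
  with assms(2-) show ?thesis by iprover
qed

lemma srct_first_column:
  assumes "\<tau> \<in> srct \<alpha>" "(i, 1) \<in> diagram \<alpha>" "(i', 1) \<in> diagram \<alpha>" "i < i'"
  shows "\<tau> (i, 1) < \<tau> (i', 1)"
proof -
  have "\<forall>i i'. (i, 1) \<in> diagram \<alpha> \<and> (i', 1) \<in> diagram \<alpha> \<and> i < i' \<longrightarrow> \<tau> (i, 1) < \<tau> (i', 1)"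
    using assms(1) unfolding srct_def mem_Collect_eq by (elim conjE)
  with assms(2-) show ?thesis by iprover
qed

lemma srct_triple:
  assumes "\<tau> \<in> srct \<alpha>" "i < j" "(i, k) \<in> diagram \<alpha>" "(j, k + 1) \<in> diagram \<alpha>"
    "\<tau> (j, k + 1) < \<tau> (i, k)"
  shows "(i, k + 1) \<in> diagram \<alpha> \<and> \<tau> (j, k + 1) < \<tau> (i, k + 1)"
proof -
  have "\<forall>i j k. i < j \<and> (i, k) \<in> diagram \<alpha> \<and> (j, k + 1) \<in> diagram \<alpha> \<and>
      \<tau> (i, k) > \<tau> (j, k + 1) \<longrightarrow> (i, k + 1) \<in> diagram \<alpha> \<and> \<tau> (i, k + 1) > \<tau> (j, k + 1)"
    using assms(1) unfolding srct_def mem_Collect_eq by (elim conjE)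
  with assms(2-) show ?thesis by iprover
qed

lemma srctI:
  assumes "bij_betw \<tau> (diagram \<alpha>) {1..sum_list \<alpha>}"
    and "\<And>c. c \<notin> diagram \<alpha> \<Longrightarrow> \<tau> c = 0"
    and "\<And>i j j'. \<lbrakk>(i, j) \<in> diagram \<alpha>; (i, j') \<in> diagram \<alpha>; j < j'\<rbrakk> \<Longrightarrow> \<tau> (i, j') < \<tau> (i, j)"
    and "\<And>i i'. \<lbrakk>(i, 1) \<in> diagram \<alpha>; (i', 1) \<in> diagram \<alpha>; i < i'\<rbrakk> \<Longrightarrow> \<tau> (i, 1) < \<tau> (i', 1)"
    and "\<And>i j k. \<lbrakk>i < j; (i, k) \<in> diagram \<alpha>; (j, k + 1) \<in> diagram \<alpha>; \<tau> (j, k + 1) < \<tau> (i, k)\<rbrakk> \<Longrightarrow>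
        (i, k + 1) \<in> diagram \<alpha> \<and> \<tau> (j, k + 1) < \<tau> (i, k + 1)"
  shows "\<tau> \<in> srct \<alpha>"
proof -
  have "\<forall>c. c \<notin> diagram \<alpha> \<longrightarrow> \<tau> c = 0"
    by (intro allI impI) (rule assms(2))
  moreover have "\<forall>i j j'. (i, j) \<in> diagram \<alpha> \<and> (i, j') \<in> diagram \<alpha> \<and> j < j' \<longrightarrow>
      \<tau> (i, j') < \<tau> (i, j)"
    by (intro allI impI, elim conjE) (rule assms(3))
  moreover have "\<forall>i i'. (i, 1) \<in> diagram \<alpha> \<and> (i', 1) \<in> diagram \<alpha> \<and> i < i' \<longrightarrow>
      \<tau> (i, 1) < \<tau> (i', 1)"
    by (intro allI impI, elim conjE) (rule assms(4))
  moreover have "\<forall>i j k. i < j \<and> (i, k) \<in> diagram \<alpha> \<and> (j, k + 1) \<in> diagram \<alpha> \<and>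
      \<tau> (j, k + 1) < \<tau> (i, k) \<longrightarrow> (i, k + 1) \<in> diagram \<alpha> \<and> \<tau> (j, k + 1) < \<tau> (i, k + 1)"
    by (intro allI impI, elim conjE) (rule assms(5))
  ultimately show ?thesis
    unfolding srct_def mem_Collect_eq using assms(1) by (intro conjI)
qed

lemma srct_inj_entries:
  assumes "\<tau> \<in> srct \<alpha>"
  shows "inj_entries \<tau>"
  unfolding inj_entries_def
proof (intro allI impI)
  fix c c' assume "\<tau> c = \<tau> c'" "\<tau> c \<noteq> 0"
  then show "c = c'"
    using srct_zero_iff[OF assms] bij_betw_imp_inj_on[OF srct_bij[OF assms]]
    by (metis inj_onD)
qed

lemma srct_entry:
  assumes "\<tau> \<in> srct \<alpha>" "1 \<le> i" "i \<le> sum_list \<alpha>"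
  obtains p where "p \<in> diagram \<alpha>" "\<tau> p = i"
proof -
  have "i \<in> \<tau> ` diagram \<alpha>"
    using bij_betw_imp_surj_on[OF srct_bij[OF assms(1)]] assms(2,3) by simp
  then show ?thesis using that by blast
qed

text \<open>Exchanging consecutive values changes the outcome of a comparison only between
  \<open>p\<close> and \<open>q\<close>, and no tableau condition compares these two. They are not
  in one row, because entries decrease to the right there; they are not in one column; and the
  remaining comparison, of (r, k) with (j, k + 1) for r < j, would make them attack or put
  \<open>q\<close> left of \<open>p\<close>.\<close>

lemma swap_entries_srct:
  assumes \<tau>: "\<tau> \<in> srct \<alpha>" and p: "\<tau> p = i" and q: "\<tau> q = Suc i" and i: "1 \<le> i"
    and pq: "snd p < snd q" "\<not> attack p q"
  shows "swap_entries i \<tau> \<in> srct \<alpha>"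
proof -
  note inj = srct_inj_entries[OF \<tau>]
  have cells: "p \<in> diagram \<alpha>" "q \<in> diagram \<alpha>"
    using srct_zero_iff[OF \<tau>, of p] srct_zero_iff[OF \<tau>, of q] p q i by auto
  have p_iff: "\<tau> c = i \<longleftrightarrow> c = p" for c
    using inj_entries_unique[OF inj p, of c] p i by (metis less_le_trans zero_less_one)
  have q_iff: "\<tau> c = Suc i \<longleftrightarrow> c = q" for c
    using inj_entries_unique[OF inj q, of c] q by (metis zero_less_Suc)
  have less: "swap_entries i \<tau> c < swap_entries i \<tau> d \<longleftrightarrow> \<tau> c < \<tau> d"
    if "\<not> (c = p \<and> d = q)" "\<not> (c = q \<and> d = p)" for c d
  proof -
    have "\<not> (\<tau> c = i \<and> \<tau> d = Suc i)" "\<not> (\<tau> c = Suc i \<and> \<tau> d = i)"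
      using that unfolding p_iff q_iff by blast+
    then show ?thesis by (simp add: swap_entries_apply) linarith
  qed
  have same_row: "fst p \<noteq> fst q"
    using srct_row_decreasing[OF \<tau>, of "fst p" "snd p" "snd q"] cells pq p q by auto
  have adjacent: "\<not> (i' < j \<and> p = (i', k) \<and> q = (j, k + 1))" "\<not> (p = (j, k + 1) \<and> q = (i', k))"
    for i' j k
    using pq by (auto simp: attack_def)
  show ?thesis
  proof (rule srctI)
    \<comment> \<open>Since \<open>Suc i\<close> is the entry at \<open>q\<close>, it is at most
      \<open>sum_list \<alpha>\<close>, and the transposition preserves the interval.\<close>
    have "bij_betw (transpose i (i + 1)) {1..sum_list \<alpha>} {1..sum_list \<alpha>}"
      using bij_betwE[OF srct_bij[OF \<tau>], rule_format, OF cells(2)] q i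
      by (intro bij_betw_byWitness[where f'="transpose i (i + 1)"])
        (auto simp: transpose_def)
    then show "bij_betw (swap_entries i \<tau>) (diagram \<alpha>) {1..sum_list \<alpha>}"
      unfolding swap_entries_def using srct_bij[OF \<tau>] bij_betw_trans by blast
  next
    fix c assume "c \<notin> diagram \<alpha>"
    then show "swap_entries i \<tau> c = 0"
      using srct_zero_iff[OF \<tau>, of c] i by (simp add: swap_entries_apply)
  next
    fix r j j' assume "(r, j) \<in> diagram \<alpha>" "(r, j') \<in> diagram \<alpha>" "j < j'"
    from srct_row_decreasing[OF \<tau> this]
    show "swap_entries i \<tau> (r, j') < swap_entries i \<tau> (r, j)"
      using same_row by (subst less) auto
  next
    fix r r' assume "(r, 1) \<in> diagram \<alpha>" "(r', 1) \<in> diagram \<alpha>" "r < r'"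
    from srct_first_column[OF \<tau> this]
    show "swap_entries i \<tau> (r, 1) < swap_entries i \<tau> (r', 1)"
      using pq by (subst less) auto
  next
    fix r j k
    assume *: "r < j" "(r, k) \<in> diagram \<alpha>" "(j, k + 1) \<in> diagram \<alpha>"
      "swap_entries i \<tau> (j, k + 1) < swap_entries i \<tau> (r, k)"
    have "\<tau> (j, k + 1) < \<tau> (r, k)"
      using *(4) by (subst (asm) less) (use adjacent[of r j k] *(1) pq in auto)
    then have "(r, k + 1) \<in> diagram \<alpha>" "\<tau> (j, k + 1) < \<tau> (r, k + 1)"
      using srct_triple[OF \<tau> *(1-3)] by auto
    moreover from this have "swap_entries i \<tau> (j, k + 1) < swap_entries i \<tau> (r, k + 1)"
      by (subst less) (use pq in auto)
    ultimately show "(r, k + 1) \<in> diagram \<alpha> \<and>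
        swap_entries i \<tau> (j, k + 1) < swap_entries i \<tau> (r, k + 1)"
      by simp
  qed
qed

lemma pi_op_cases:
  assumes "\<tau> \<in> srct \<alpha>"
  shows "pi_op i \<tau> = Poly_Mapping.single \<tau> 1 \<or> pi_op i \<tau> = 0 \<or>
    pi_op i \<tau> = Poly_Mapping.single (swap_entries i \<tau>) 1 \<and> swap_entries i \<tau> \<in> srct \<alpha>"
proof (cases "i \<in> Des \<tau> \<and> \<not> attacking \<tau> i")
  case True
  then obtain r c r' c' where "\<tau> (r, c) = i" "\<tau> (r', c') = Suc i" "1 \<le> i"
    unfolding Des_def Suc_eq_plus1 by blast
  then obtain p q where pq: "\<tau> p = i" "\<tau> q = Suc i" "1 \<le> i"
    by blast
  from True have "snd p \<le> snd q" "\<not> attack p q"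
    using Des_iff[OF srct_inj_entries[OF assms] pq]
      attacking_iff[OF srct_inj_entries[OF assms] pq] by simp_all
  then have "snd p < snd q" "\<not> attack p q"
    unfolding attack_def by linarith+
  then have "swap_entries i \<tau> \<in> srct \<alpha>"
    by (rule swap_entries_srct[OF assms pq])
  with True show ?thesis by (simp add: pi_op_def)
next
  case False
  then show ?thesis by (cases "i \<in> Des \<tau>") (simp_all add: pi_op_def)
qed

lemma keys_pi_op:
  assumes "\<tau> \<in> srct \<alpha>"
  shows "Poly_Mapping.keys (pi_op i \<tau>) \<subseteq> srct \<alpha>"
  using pi_op_cases[OF assms, of i] assms by (elim disjE conjE) simp_all

lemma keys_word_action:
  assumes "Poly_Mapping.keys v \<subseteq> srct \<alpha>"
  shows "Poly_Mapping.keys (word_action w v) \<subseteq> srct \<alpha>"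
proof -
  have "Poly_Mapping.keys (foldr pi_lin ws v) \<subseteq> srct \<alpha>" for ws
  proof (induction ws)
    case (Cons i ws)
    have "Poly_Mapping.keys (pi_lin i (foldr pi_lin ws v)) \<subseteq> srct \<alpha>"
      by (rule keys_linear_extension) (rule keys_pi_op[OF subsetD[OF Cons.IH]])
    then show ?case by simp
  qed (use assms in simp)
  then show ?thesis by (simp add: word_action_def)
qed

lemma keys_free_action:
  "Poly_Mapping.keys v \<subseteq> srct \<alpha> \<Longrightarrow> Poly_Mapping.keys (free_action f v) \<subseteq> srct \<alpha>"
  unfolding free_action_def by (rule keys_linear_extension) (rule keys_word_action)

section \<open>The Hecke relators act as zero\<close>

lemmas free_action_simps =
  complex_linear_diff[OF complex_linear_free_action_left] free_action_mult free_action_gen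

text \<open>By linearity one tableau is enough. The indices in a relator are below the size of the
  shape and a tableau contains every number up to its size, so the cells that the operator
  identities ask for exist.\<close>

lemma relator_annihilates:
  assumes "f \<in> hecke_relators (sum_list \<alpha>)" "Poly_Mapping.keys v \<subseteq> srct \<alpha>"
  shows "free_action f v = 0"
proof -
  have "free_action f (Poly_Mapping.single \<tau> 1) = 0" if \<tau>: "\<tau> \<in> srct \<alpha>" for \<tau>
  proof -
    note inj = srct_inj_entries[OF \<tau>]
    have entries: "\<exists>p q. \<tau> p = i \<and> \<tau> q = Suc i" if "i \<in> {1..<sum_list \<alpha>}" for i
    proof -
      have i: "1 \<le> i" "i \<le> sum_list \<alpha>" "1 \<le> Suc i" "Suc i \<le> sum_list \<alpha>"
        using that by simp_all
      obtain p where "\<tau> p = i" by (rule srct_entry[OF \<tau> i(1,2)])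
      moreover obtain q where "\<tau> q = Suc i" by (rule srct_entry[OF \<tau> i(3,4)])
      ultimately show ?thesis by (intro exI conjI)
    qed
    consider i where "i \<in> {1..<sum_list \<alpha>}" "f = gen i * gen i - gen i"
      | i where "i \<in> {1..<sum_list \<alpha>}" "i + 1 \<in> {1..<sum_list \<alpha>}"
          "f = gen i * gen (i + 1) * gen i - gen (i + 1) * gen i * gen (i + 1)"
      | i j where "i \<in> {1..<sum_list \<alpha>}" "j \<in> {1..<sum_list \<alpha>}" "\<bar>int i - int j\<bar> \<ge> 2"
          "f = gen i * gen j - gen j * gen i"
      using assms(1) unfolding hecke_relators_def by blast
    then show ?thesis
    proof cases
      case (1 i)
      obtain p q where "\<tau> p = i" "\<tau> q = Suc i"
        using entries[OF 1(1)] by (elim exE conjE)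
      moreover have "1 \<le> i" using 1(1) by simp
      ultimately have "pi_lin i (pi_lin i (Poly_Mapping.single \<tau> 1)) =
          pi_lin i (Poly_Mapping.single \<tau> 1)"
        by (rule pi_idem[OF inj])
      then show ?thesis
        unfolding 1(2) free_action_simps by (simp only: diff_self)
    next
      case (2 i)
      obtain p q where "\<tau> p = i" "\<tau> q = Suc i"
        using entries[OF 2(1)] by (elim exE conjE)
      moreover obtain r where "\<tau> r = Suc (Suc i)"
        using entries[OF 2(2)] unfolding Suc_eq_plus1 by (elim exE conjE)
      ultimately have "three_cells i \<tau> p q r" using 2(1) inj by (simp add: three_cells_def)
      from pi_braid[OF this] show ?thesis
        unfolding 2(3) free_action_simps Suc_eq_plus1 by (simp only: diff_self)
    next
      case (3 i j)
      obtain p q where "\<tau> p = i" "\<tau> q = Suc i"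
        using entries[OF 3(1)] by (elim exE conjE)
      moreover obtain r s where "\<tau> r = j" "\<tau> s = Suc j"
        using entries[OF 3(2)] by (elim exE conjE)
      moreover have "1 \<le> i" "1 \<le> j" using 3(1,2) by simp_all
      ultimately have "pi_lin i (pi_lin j (Poly_Mapping.single \<tau> 1)) =
          pi_lin j (pi_lin i (Poly_Mapping.single \<tau> 1))"
        by (rule pi_commute[OF inj _ _ _ _ _ _ 3(3)])
      then show ?thesis
        unfolding 3(4) free_action_simps by (simp only: diff_self)
    qed
  qed
  moreover have "complex_linear (\<lambda>v :: filling \<Rightarrow>\<^sub>0 complex. 0 :: filling \<Rightarrow>\<^sub>0 complex)"
    by (rule complex_linearI) (simp_all only: add_0 scale_zero_right)
  ultimately show ?thesis
    using complex_linear_eqI[where g="\<lambda>v. 0", OF complex_linear_free_action_right _ assms(2)] by iprover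
qed


section \<open>The Hecke algebra acting on a tableau module\<close>

lemma free_carrier_iff:
  "f \<in> carrier (free_algebra n) \<longleftrightarrow> (\<forall>w\<in>Poly_Mapping.keys f. set (letters w) \<subseteq> {1..<n})"
  by (simp add: free_algebra_def)

lemma free_algebra_simps [simp]:
  "mult (free_algebra n) = (*)" "one (free_algebra n) = 1"
  "zero (free_algebra n) = 0" "add (free_algebra n) = (+)"
  by (simp_all add: free_algebra_def)

lemma free_carrier_zero: "0 \<in> carrier (free_algebra n)"
  by (simp add: free_carrier_iff)

lemma free_carrier_single:
  "set (letters w) \<subseteq> {1..<n} \<Longrightarrow> Poly_Mapping.single w c \<in> carrier (free_algebra n)"
  by (simp add: free_carrier_iff)

lemma free_carrier_one: "1 \<in> carrier (free_algebra n)"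
  using free_carrier_single[of 0 n 1] by (simp only: single_one) (simp add: zero_word_def)

lemma free_carrier_gen: "i \<in> {1..<n} \<Longrightarrow> gen i \<in> carrier (free_algebra n)"
  unfolding gen_def by (rule free_carrier_single) simp

lemma free_carrier_add:
  "\<lbrakk>f \<in> carrier (free_algebra n); g \<in> carrier (free_algebra n)\<rbrakk> \<Longrightarrow>
    f + g \<in> carrier (free_algebra n)"
  using Poly_Mapping.keys_add[of f g] unfolding free_carrier_iff by blast

lemma free_carrier_diff:
  "\<lbrakk>f \<in> carrier (free_algebra n); g \<in> carrier (free_algebra n)\<rbrakk> \<Longrightarrow>
    f - g \<in> carrier (free_algebra n)"
  using Poly_Mapping.keys_diff[of f g] unfolding free_carrier_iff by blast

lemma free_carrier_uminus:
  "f \<in> carrier (free_algebra n) \<Longrightarrow> - f \<in> carrier (free_algebra n)"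
  using free_carrier_diff[OF free_carrier_zero, of f n] by simp

lemma free_carrier_mult:
  assumes "f \<in> carrier (free_algebra n)" "g \<in> carrier (free_algebra n)"
  shows "f * g \<in> carrier (free_algebra n)"
  unfolding free_carrier_iff
proof
  fix w assume "w \<in> Poly_Mapping.keys (f * g)"
  then obtain u v where "w = u + v" "u \<in> Poly_Mapping.keys f" "v \<in> Poly_Mapping.keys g"
    using Poly_Mapping.keys_mult[of f g] by blast
  then show "set (letters w) \<subseteq> {1..<n}"
    using assms unfolding free_carrier_iff by (simp add: plus_word_def)
qed

lemma ring_free_algebra: "ring (free_algebra n)"
proof (rule ringI)
  show "abelian_group (free_algebra n)"
  proof (rule abelian_groupI)
    fix f assume "f \<in> carrier (free_algebra n)"
    then have "- f \<in> carrier (free_algebra n)"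
      by (rule free_carrier_uminus)
    then show "\<exists>g\<in>carrier (free_algebra n).
        g \<oplus>\<^bsub>free_algebra n\<^esub> f = \<zero>\<^bsub>free_algebra n\<^esub>"
      by (intro bexI[of _ "- f"]) simp_all
  qed (simp_all add: free_carrier_add free_carrier_zero add.assoc add.commute)
  show "monoid (free_algebra n)"
    by (rule monoidI) (simp_all add: free_carrier_mult free_carrier_one mult.assoc)
qed (simp_all add: distrib_left distrib_right)

lemma hecke_relators_carrier: "hecke_relators n \<subseteq> carrier (free_algebra n)"
  unfolding hecke_relators_def
  by (intro Un_least subsetI; clarify;
      intro free_carrier_diff free_carrier_mult free_carrier_gen; assumption)

lemma ideal_hecke_ideal: "ideal (hecke_ideal n) (free_algebra n)"
  unfolding hecke_ideal_def
  by (rule ring.genideal_ideal[OF ring_free_algebra hecke_relators_carrier])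

lemma ring_hecke0: "ring (hecke0 n)"
  unfolding hecke0_def by (rule ideal.quotient_is_ring[OF ideal_hecke_ideal])

lemma hecke_ideal_carrier: "f \<in> hecke_ideal n \<Longrightarrow> f \<in> carrier (free_algebra n)"
  using ideal_hecke_ideal by (rule ideal.Icarr)

text \<open>The annihilator of the span is a two-sided ideal containing the relators, hence contains
  the ideal they generate.\<close>

lemma hecke_ideal_annihilates:
  assumes "f \<in> hecke_ideal (sum_list \<alpha>)" "Poly_Mapping.keys v \<subseteq> srct \<alpha>"
  shows "free_action f v = 0"
proof -
  let ?R = "free_algebra (sum_list \<alpha>)"
  \<comment> \<open>The annihilator of a single vector would only be a left ideal. Quantifying over
    all \<open>v\<close> gives closure under right multiplication, because the span is stable under
    the free algebra.\<close>
  define J where "J = {f \<in> carrier ?R.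
    \<forall>v. Poly_Mapping.keys v \<subseteq> srct \<alpha> \<longrightarrow> free_action f v = 0}"
  interpret R: ring ?R by (rule ring_free_algebra)
  have "ideal J ?R"
  proof (rule idealI[OF ring_free_algebra])
    show "subgroup J (add_monoid ?R)"
    proof (rule R.add.subgroupI)
      show "J \<noteq> {}"
        using free_carrier_zero complex_linear_zero[OF complex_linear_free_action_left] unfolding J_def by blast
      fix f assume f: "f \<in> J"
      then have minus: "\<ominus>\<^bsub>?R\<^esub> f = - f"
        by (intro R.minus_equality) (simp_all add: J_def free_carrier_uminus)
      have "free_action (- f) v = - free_action f v" for v
        using complex_linear_diff[OF complex_linear_free_action_left, of 0 f v]
          complex_linear_zero[OF complex_linear_free_action_left, of v]
        by simp
      then show "\<ominus>\<^bsub>?R\<^esub> f \<in> J"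
        unfolding minus using f by (simp add: J_def free_carrier_uminus)
      fix g assume "g \<in> J"
      with f show "f \<oplus>\<^bsub>?R\<^esub> g \<in> J"
        unfolding J_def by (simp add: free_carrier_add free_action_linear)
    qed (simp add: J_def)
    fix f g assume "f \<in> J" "g \<in> carrier ?R"
    then show "g \<otimes>\<^bsub>?R\<^esub> f \<in> J" "f \<otimes>\<^bsub>?R\<^esub> g \<in> J"
      unfolding J_def
      by (simp_all add: free_carrier_mult free_action_mult complex_linear_zero[OF complex_linear_free_action_right]
          keys_free_action)
  qed
  moreover have "hecke_relators (sum_list \<alpha>) \<subseteq> J"
    using subsetD[OF hecke_relators_carrier] relator_annihilates unfolding J_def
    by (intro subsetI CollectI conjI allI impI)
  ultimately have "hecke_ideal (sum_list \<alpha>) \<subseteq> J"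
    unfolding hecke_ideal_def by (rule R.genideal_minimal)
  with assms show ?thesis unfolding J_def by blast
qed

lemma srct_module_simps [simp]:
  "carrier (\<^bold>S \<alpha>) = {v. Poly_Mapping.keys v \<subseteq> srct \<alpha>}"
  "zero (\<^bold>S \<alpha>) = 0" "add (\<^bold>S \<alpha>) = (+)"
  by (simp_all add: srct_module_def)

text \<open>\<open>the_elem\<close> yields the intended value once the image is a singleton. As
  \<open>X\<close> may be any set, this serves cosets as well as images of cosets under
  \<open>hecke_embedding\<close>.\<close>

lemma smult_srct_module:
  assumes "f \<in> X" "\<And>g. g \<in> X \<Longrightarrow> free_action g v = free_action f v"
  shows "X \<odot>\<^bsub>\<^bold>S \<alpha>\<^esub> v = free_action f v"
proof -
  have "(\<lambda>g. free_action g v) ` X = (\<lambda>g. free_action f v) ` X"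
    by (rule image_cong[OF refl assms(2)])
  then have "(\<lambda>g. free_action g v) ` X = {free_action f v}"
    by (simp only: image_constant[OF assms(1)])
  then show ?thesis by (simp add: srct_module_def)
qed

lemma free_action_coset:
  assumes "g \<in> hecke_ideal (sum_list \<alpha>) +>\<^bsub>free_algebra (sum_list \<alpha>)\<^esub> f"
    and "Poly_Mapping.keys v \<subseteq> srct \<alpha>"
  shows "free_action g v = free_action f v"
proof -
  obtain h where "h \<in> hecke_ideal (sum_list \<alpha>)" "g = h + f"
    using assms(1) by (auto simp: a_r_coset_def')
  then show ?thesis
    using hecke_ideal_annihilates[OF _ assms(2)] by (simp add: free_action_linear)
qed

lemma coset_self:
  "f \<in> carrier (free_algebra n) \<Longrightarrow> f \<in> hecke_ideal n +>\<^bsub>free_algebra n\<^esub> f"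
  using ideal_hecke_ideal[THEN ideal.axioms(1), THEN additive_subgroup.zero_closed]
  by (force simp: a_r_coset_def')

lemma smult_coset:
  assumes "f \<in> carrier (free_algebra (sum_list \<alpha>))" "Poly_Mapping.keys v \<subseteq> srct \<alpha>"
  shows "(hecke_ideal (sum_list \<alpha>) +>\<^bsub>free_algebra (sum_list \<alpha>)\<^esub> f) \<odot>\<^bsub>\<^bold>S \<alpha>\<^esub> v = free_action f v"
  by (rule smult_srct_module[OF coset_self[OF assms(1)] free_action_coset[OF _ assms(2)]])

lemma hecke0_cosetE:
  assumes "X \<in> carrier (hecke0 n)"
  obtains f where "f \<in> carrier (free_algebra n)" "X = hecke_ideal n +>\<^bsub>free_algebra n\<^esub> f"
  using assms by (auto simp: hecke0_def FactRing_def A_RCOSETS_def')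

lemma abelian_group_srct_module: "abelian_group (\<^bold>S \<alpha>)"
proof (rule abelian_groupI)
  fix u v assume "u \<in> carrier (\<^bold>S \<alpha>)" "v \<in> carrier (\<^bold>S \<alpha>)"
  then show "u \<oplus>\<^bsub>\<^bold>S \<alpha>\<^esub> v \<in> carrier (\<^bold>S \<alpha>)"
    using Poly_Mapping.keys_add[of u v] by (simp add: subset_trans[of _ "_ \<union> _"])
next
  fix v assume "v \<in> carrier (\<^bold>S \<alpha>)"
  then show "\<exists>u\<in>carrier (\<^bold>S \<alpha>). u \<oplus>\<^bsub>\<^bold>S \<alpha>\<^esub> v = \<zero>\<^bsub>\<^bold>S \<alpha>\<^esub>"
    by (intro bexI[of _ "- v"]) simp_all
qed (simp_all add: add.assoc add.commute)

text \<open>After the choice of representatives, every axiom is an identity for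
  \<open>free_action\<close>.\<close>

lemma left_module_srct_module: "left_module (hecke0 (sum_list \<alpha>)) (\<^bold>S \<alpha>)"
proof -
  let ?n = "sum_list \<alpha>"
  let ?coset = "\<lambda>f. hecke_ideal ?n +>\<^bsub>free_algebra ?n\<^esub> f"
  interpret I: ideal "hecke_ideal ?n" "free_algebra ?n" by (rule ideal_hecke_ideal)
  have add: "?coset f \<oplus>\<^bsub>hecke0 ?n\<^esub> ?coset g = ?coset (f + g)"
    and mult: "?coset f \<otimes>\<^bsub>hecke0 ?n\<^esub> ?coset g = ?coset (f * g)"
    if "f \<in> carrier (free_algebra ?n)" "g \<in> carrier (free_algebra ?n)" for f g
    using I.a_rcos_sum[OF that] I.rcoset_mult_add[OF that]
    by (simp_all add: hecke0_def FactRing_def)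
  have one: "\<one>\<^bsub>hecke0 ?n\<^esub> = ?coset 1"
    by (simp add: hecke0_def FactRing_def)
  show ?thesis
  proof (intro left_module.intro left_module_axioms.intro ring_hecke0 abelian_group_srct_module)
    fix X v assume "X \<in> carrier (hecke0 ?n)" "v \<in> carrier (\<^bold>S \<alpha>)"
    then show "X \<odot>\<^bsub>\<^bold>S \<alpha>\<^esub> v \<in> carrier (\<^bold>S \<alpha>)"
      by (elim hecke0_cosetE) (simp add: smult_coset keys_free_action)
  next
    fix X Y v
    assume *: "X \<in> carrier (hecke0 ?n)" "Y \<in> carrier (hecke0 ?n)" "v \<in> carrier (\<^bold>S \<alpha>)"
    then obtain f g where "f \<in> carrier (free_algebra ?n)" "X = ?coset f"
      "g \<in> carrier (free_algebra ?n)" "Y = ?coset g"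
      by (elim hecke0_cosetE)
    with *(3) show "(X \<oplus>\<^bsub>hecke0 ?n\<^esub> Y) \<odot>\<^bsub>\<^bold>S \<alpha>\<^esub> v =
        X \<odot>\<^bsub>\<^bold>S \<alpha>\<^esub> v \<oplus>\<^bsub>\<^bold>S \<alpha>\<^esub> Y \<odot>\<^bsub>\<^bold>S \<alpha>\<^esub> v"
      and "(X \<otimes>\<^bsub>hecke0 ?n\<^esub> Y) \<odot>\<^bsub>\<^bold>S \<alpha>\<^esub> v = X \<odot>\<^bsub>\<^bold>S \<alpha>\<^esub> (Y \<odot>\<^bsub>\<^bold>S \<alpha>\<^esub> v)"
      by (simp_all add: add mult smult_coset free_carrier_add free_carrier_mult
          free_action_linear free_action_mult keys_free_action)
  next
    fix X u v
    assume *: "X \<in> carrier (hecke0 ?n)" "u \<in> carrier (\<^bold>S \<alpha>)" "v \<in> carrier (\<^bold>S \<alpha>)"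
    have uv: "Poly_Mapping.keys (u + v) \<subseteq> srct \<alpha>"
      using *(2,3) Poly_Mapping.keys_add[of u v] by (simp add: subset_trans[of _ "_ \<union> _"])
    from *(1) obtain f where "f \<in> carrier (free_algebra ?n)" "X = ?coset f"
      by (elim hecke0_cosetE)
    with *(2,3) show "X \<odot>\<^bsub>\<^bold>S \<alpha>\<^esub> (u \<oplus>\<^bsub>\<^bold>S \<alpha>\<^esub> v) =
        X \<odot>\<^bsub>\<^bold>S \<alpha>\<^esub> u \<oplus>\<^bsub>\<^bold>S \<alpha>\<^esub> X \<odot>\<^bsub>\<^bold>S \<alpha>\<^esub> v"
      by (simp add: smult_coset uv free_action_linear)
  next
    fix v assume "v \<in> carrier (\<^bold>S \<alpha>)"
    then show "\<one>\<^bsub>hecke0 ?n\<^esub> \<odot>\<^bsub>\<^bold>S \<alpha>\<^esub> v = v"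
      by (simp add: one smult_coset free_carrier_one)
  qed
qed


section \<open>Removing the cell with entry 1\<close>

text \<open>If the removed node is a whole part, the rows below it move up by one. Adding
  \<open>row_shift\<close> to a row of the smaller diagram gives the row of \<open>\<alpha>\<close>
  it comes from; one constant for all rows is enough because such a node lies in row 1.\<close>

definition row_shift :: "nat list \<Rightarrow> nat \<Rightarrow> nat" where
  "row_shift \<alpha> i = (if part \<alpha> i = 1 then 1 else 0)"

lemma part_one_removable:
  "\<lbrakk>has_removable_node \<alpha> i; part \<alpha> i = 1\<rbrakk> \<Longrightarrow> i = 1"
  by (auto simp: has_removable_node_def)

text \<open>All parts are positive, so the filter in \<open>remove_node\<close> drops something only
  when the lowered part was 1, and a removable part equal to 1 is the first one.\<close>

lemma remove_node_cases:
  assumes "\<forall>a\<in>set \<alpha>. 0 < a" "has_removable_node \<alpha> i"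
  obtains (delete) \<beta> where "i = 1" "\<alpha> = 1 # \<beta>" "remove_node \<alpha> i = \<beta>"
  | (decrease) "2 \<le> part \<alpha> i" "remove_node \<alpha> i = \<alpha>[i - 1 := part \<alpha> i - 1]"
proof (cases "part \<alpha> i = 1")
  case True
  with assms(2) have i: "i = 1" by (rule part_one_removable)
  with assms(2) True obtain \<beta> where \<beta>: "\<alpha> = 1 # \<beta>"
    by (cases \<alpha>) (auto simp: has_removable_node_def)
  with assms(1) have "filter (\<lambda>a. a \<noteq> 0) \<beta> = \<beta>"
    by (auto simp: filter_id_conv)
  with i \<beta> show ?thesis
    by (intro delete) (simp_all add: remove_node_def)
next
  case False
  have "i - 1 < length \<alpha>" using assms(2) by (auto simp: has_removable_node_def)
  with assms(1) False have "2 \<le> part \<alpha> i"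
    using nth_mem[of "i - 1" \<alpha>] by (metis One_nat_def Suc_leI le_neq_implies_less numeral_2_eq_2)
  moreover from this have "\<forall>a\<in>set (\<alpha>[i - 1 := part \<alpha> i - 1]). a \<noteq> 0"
    using assms(1) set_update_subset_insert[of \<alpha> "i - 1" "part \<alpha> i - 1"] by fastforce
  ultimately show ?thesis
    by (intro decrease) (simp_all add: remove_node_def filter_id_conv)
qed

lemma sum_list_remove_node:
  assumes "\<forall>a\<in>set \<alpha>. 0 < a" "has_removable_node \<alpha> i"
  shows "sum_list (remove_node \<alpha> i) = sum_list \<alpha> - 1"
  using assms
proof (cases rule: remove_node_cases)
  case decrease
  have "i - 1 < length \<alpha>" using assms(2) by (auto simp: has_removable_node_def)
  then show ?thesis
    using decrease by (simp add: sum_list_update member_le_sum_list[OF nth_mem])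
qed simp

lemma remove_node_positive: "\<forall>a\<in>set (remove_node \<alpha> i). 0 < a"
  by (simp add: remove_node_def)

lemma removable_cell:
  assumes "\<forall>a\<in>set \<alpha>. 0 < a" "has_removable_node \<alpha> i"
  shows "(i, part \<alpha> i) \<in> diagram \<alpha>"
proof -
  have "1 \<le> i" "i \<le> length \<alpha>" using assms(2) by (auto simp: has_removable_node_def)
  moreover from this have "0 < part \<alpha> i" using assms(1) by simp
  ultimately show ?thesis by (simp add: diagram_def)
qed

lemma diagram_remove_node:
  assumes "\<forall>a\<in>set \<alpha>. 0 < a" "has_removable_node \<alpha> i"
  shows "(r, c) \<in> diagram (remove_node \<alpha> i) \<longleftrightarrow>
    1 \<le> r \<and> (r + row_shift \<alpha> i, c) \<in> diagram \<alpha> \<and> (r + row_shift \<alpha> i, c) \<noteq> (i, part \<alpha> i)"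
  using assms
proof (cases rule: remove_node_cases)
  case (delete \<beta>)
  then show ?thesis by (cases r) (auto simp: diagram_def row_shift_def)
next
  case decrease
  have "1 \<le> i" "i \<le> length \<alpha>" using assms(2) by (auto simp: has_removable_node_def)
  with decrease show ?thesis
    by (cases "r = i") (auto simp: diagram_def row_shift_def nth_list_update)
qed

text \<open>When row 1 disappears, its only cell is the removed one. Every other cell then lies in
  row 2 or below, so subtracting the shift leaves a legal row number.\<close>

lemma diagram_row_shift:
  assumes "\<forall>a\<in>set \<alpha>. 0 < a" "has_removable_node \<alpha> i" "(r, c) \<in> diagram \<alpha>" "(r, c) \<noteq> (i, part \<alpha> i)"
  obtains r' where "r = r' + row_shift \<alpha> i" "(r', c) \<in> diagram (remove_node \<alpha> i)"
proof -
  have "row_shift \<alpha> i < r"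
    using assms
  proof (cases rule: remove_node_cases)
    case (delete \<beta>)
    with assms(3,4) show ?thesis by (cases "r = 1") (auto simp: diagram_def row_shift_def)
  qed (use assms(3) in \<open>auto simp: diagram_def row_shift_def\<close>)
  then have "r = (r - row_shift \<alpha> i) + row_shift \<alpha> i" "1 \<le> r - row_shift \<alpha> i" by simp_all
  with assms diagram_remove_node[OF assms(1,2), of "r - row_shift \<alpha> i" c] that
  show ?thesis by metis
qed

text \<open>The direct sum runs over compositions, while the entry 1 marks a node; this matches the
  two. Deleting a part shortens the list and lowering one does not, and two lowerings at different
  positions disagree at either position.\<close>

lemma remove_node_inj:
  assumes "\<forall>a\<in>set \<alpha>. 0 < a" "has_removable_node \<alpha> i" "has_removable_node \<alpha> j"
    "remove_node \<alpha> i = remove_node \<alpha> j"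
  shows "i = j"
proof -
  have "1 \<le> i" "i \<le> length \<alpha>" "1 \<le> j" "j \<le> length \<alpha>"
    using assms(2,3) by (auto simp: has_removable_node_def)
  note bounds = this
  show ?thesis
    using assms(1,2)
  proof (cases rule: remove_node_cases)
    case i: (delete \<beta>)
    show ?thesis
      using assms(1,3)
    proof (cases rule: remove_node_cases)
      case decrease
      then have "length (remove_node \<alpha> j) = length \<alpha>" by simp
      with i assms(4) show ?thesis by simp
    qed (use i in simp)
  next
    case i: decrease
    show ?thesis
      using assms(1,3)
    proof (cases rule: remove_node_cases)
      case (delete \<beta>)
      from i have "length (remove_node \<alpha> i) = length \<alpha>" by simp
      with delete assms(4) show ?thesis by simp
    next
      case j: decrease
      show ?thesis
      proof (rule ccontr)
        assume "i \<noteq> j"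
        have "\<alpha>[i - 1 := part \<alpha> i - 1] ! (i - 1) = \<alpha>[j - 1 := part \<alpha> j - 1] ! (i - 1)"
          using assms(4) i(2) j(2) by simp
        with \<open>i \<noteq> j\<close> i(1) bounds show False by (simp add: nth_list_update)
      qed
    qed
  qed
qed

text \<open>With positive parts the first column counts the rows, and the cells of a row count its
  part.\<close>

lemma diagram_inject:
  assumes "\<forall>a\<in>set \<alpha>. 0 < a" "\<forall>a\<in>set \<beta>. 0 < a" "diagram \<alpha> = diagram \<beta>"
  shows "\<alpha> = \<beta>"
proof -
  have len: "i < length \<gamma> \<longleftrightarrow> (Suc i, 1) \<in> diagram \<gamma>" if "\<forall>a\<in>set \<gamma>. 0 < a" for \<gamma> :: "nat list" and i
    using that nth_mem[of i \<gamma>] by (auto simp: diagram_def Suc_le_eq)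
  have nth: "\<gamma> ! i \<ge> c \<longleftrightarrow> c = 0 \<or> (Suc i, c) \<in> diagram \<gamma>" if "i < length \<gamma>" for \<gamma> :: "nat list" and i c
    using that by (auto simp: diagram_def)
  have iff: "i < length \<alpha> \<longleftrightarrow> i < length \<beta>" for i
    using len assms by simp
  have "length \<alpha> = length \<beta>"
    using iff[of "length \<alpha>"] iff[of "length \<beta>"] by simp
  moreover have "\<alpha> ! i = \<beta> ! i" if "i < length \<alpha>" for i
    using nth[of i \<alpha> "\<alpha> ! i"] nth[of i \<alpha> "\<beta> ! i"] nth[of i \<beta> "\<alpha> ! i"] nth[of i \<beta> "\<beta> ! i"] that iff assms(3)
    by (simp add: le_antisym)
  ultimately show ?thesis by (rule nth_equalityI)
qed

text \<open>The diagram is the set of cells with nonzero entry. Hence the bases of the modules for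
  different shapes are disjoint sets of fillings, and one formal combination can be split by
  shape.\<close>

lemma srct_shape_unique:
  assumes "\<forall>a\<in>set \<alpha>. 0 < a" "\<forall>a\<in>set \<beta>. 0 < a" "\<tau> \<in> srct \<alpha>" "\<tau> \<in> srct \<beta>"
  shows "\<alpha> = \<beta>"
proof (rule diagram_inject[OF assms(1,2)])
  show "diagram \<alpha> = diagram \<beta>"
  proof (rule Set.set_eqI)
    fix c show "c \<in> diagram \<alpha> \<longleftrightarrow> c \<in> diagram \<beta>"
      using srct_zero_iff[OF assms(3), of c] srct_zero_iff[OF assms(4), of c] by argo
  qed
qed

text \<open>Rows decrease, so 1 ends its row; the first column increases, so 1 lies in column 1 only
  when it lies in row 1. A higher row with one cell less than the row of 1 would end in the column
  just before 1 with a larger entry, and the triple rule would then demand a further cell in that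
  row.\<close>

lemma entry_one_removable:
  assumes \<tau>: "\<tau> \<in> srct \<alpha>" and "\<forall>a\<in>set \<alpha>. 0 < a" "\<tau> p = 1"
  obtains i where "has_removable_node \<alpha> i" "p = (i, part \<alpha> i)"
proof -
  obtain i c where p: "p = (i, c)" by (rule prod.exhaust)
  have pos: "1 \<le> \<tau> q" if "q \<in> diagram \<alpha>" for q
    using srct_zero_iff[OF \<tau>, of q] that by simp
  have D: "(i, c) \<in> diagram \<alpha>"
    using srct_zero_iff[OF \<tau>, of p] assms(3) p by simp
  then have bounds: "1 \<le> i" "i \<le> length \<alpha>" "1 \<le> c" "c \<le> part \<alpha> i"
    by (simp_all add: diagram_def)
  have c: "c = part \<alpha> i"
  proof (rule ccontr)
    assume "c \<noteq> part \<alpha> i"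
    with bounds have "(i, Suc c) \<in> diagram \<alpha>" by (simp add: diagram_def)
    from srct_row_decreasing[OF \<tau> D this] pos[OF this] p assms(3) show False by simp
  qed
  have "has_removable_node \<alpha> i"
  proof (cases "i = 1")
    case False
    with bounds have i: "2 \<le> i" by simp
    have first: "(1, 1) \<in> diagram \<alpha>"
      using assms(2) bounds by (cases \<alpha>) (auto simp: diagram_def)
    have "c \<noteq> 1"
    proof
      assume "c = 1"
      with srct_first_column[OF \<tau> first, of i] D i p assms(3) pos[OF first] show False by simp
    qed
    then have part2: "2 \<le> part \<alpha> i" using bounds c by simp
    have "part \<alpha> j \<noteq> part \<alpha> i - 1" if j: "1 \<le> j" "j < i" for j
    proof
      assume e: "part \<alpha> j = part \<alpha> i - 1"
      define k where "k = part \<alpha> i - 1"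
      have k: "k + 1 = c" using part2 c by (simp add: k_def)
      have Dj: "(j, k) \<in> diagram \<alpha>"
        using j bounds part2 e by (simp add: diagram_def k_def)
      have "\<tau> (i, k + 1) \<noteq> \<tau> (j, k)"
        using inj_entries_unique[OF srct_inj_entries[OF \<tau>], of p 1 "(j, k)"] p k assms(3) j
        by auto
      with pos[OF Dj] p k assms(3) have "\<tau> (i, k + 1) < \<tau> (j, k)" by simp
      with srct_triple[OF \<tau> j(2) Dj] D k have "(j, k + 1) \<in> diagram \<alpha>" by simp
      with e show False by (simp add: diagram_def k_def)
    qed
    with bounds i part2 show ?thesis unfolding has_removable_node_def by blast
  qed (use bounds in \<open>simp add: has_removable_node_def\<close>)
  with p c that show ?thesis by simp
qed


text \<open>Neither filling is assumed to be a tableau. The same setting thus serves both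
  directions: deleting the entry 1 from a given \<open>\<tau>\<close>, and inserting it into a given
  \<open>\<sigma>\<close>.\<close>

locale node_removal =
  fixes \<alpha> :: "nat list" and i :: nat and \<tau> \<sigma> :: filling
  assumes positive: "\<forall>a\<in>set \<alpha>. 0 < a"
    and removable: "has_removable_node \<alpha> i"
    and one: "\<tau> (i, part \<alpha> i) = 1"
    and outside: "\<And>c. c \<notin> diagram \<alpha> \<Longrightarrow> \<tau> c = 0"
    and shifted: "\<And>r c. (r, c) \<in> diagram (remove_node \<alpha> i) \<Longrightarrow>
      \<tau> (r + row_shift \<alpha> i, c) = Suc (\<sigma> (r, c))"
    and outside': "\<And>c. c \<notin> diagram (remove_node \<alpha> i) \<Longrightarrow> \<sigma> c = 0"
begin

abbreviation "\<beta> \<equiv> remove_node \<alpha> i"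
abbreviation "d \<equiv> row_shift \<alpha> i"

lemmas cell_iff = diagram_remove_node[OF positive removable]
lemmas cellE = diagram_row_shift[OF positive removable]

lemma image_diagram:
  "(\<lambda>(r, c). (r + d, c)) ` diagram \<beta> = diagram \<alpha> - {(i, part \<alpha> i)}"
proof (intro equalityI subsetI)
  fix p assume "p \<in> (\<lambda>(r, c). (r + d, c)) ` diagram \<beta>"
  then obtain r c where "p = (r + d, c)" "(r, c) \<in> diagram \<beta>" by auto
  then show "p \<in> diagram \<alpha> - {(i, part \<alpha> i)}" using cell_iff[of r c] by simp
next
  fix p assume p: "p \<in> diagram \<alpha> - {(i, part \<alpha> i)}"
  obtain r c where rc: "p = (r, c)" by (rule prod.exhaust)
  with p obtain r' where "r = r' + d" "(r', c) \<in> diagram \<beta>"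
    by (auto elim: cellE)
  with rc show "p \<in> (\<lambda>(r, c). (r + d, c)) ` diagram \<beta>" by force
qed

text \<open>The removed cell and its value 1 are taken out together, the remaining cells are
  renumbered by the row shift, and \<open>Suc\<close> is cancelled on the values.\<close>

lemma bij_iff:
  assumes "0 < sum_list \<alpha>"
  shows "bij_betw \<tau> (diagram \<alpha>) {1..sum_list \<alpha>} \<longleftrightarrow> bij_betw \<sigma> (diagram \<beta>) {1..sum_list \<beta>}"
proof -
  let ?x = "(i, part \<alpha> i)" and ?s = "\<lambda>(r, c). (r + d, c)"
  have x: "?x \<in> diagram \<alpha>" by (rule removable_cell[OF positive removable])
  have n: "sum_list \<alpha> = Suc (sum_list \<beta>)"
    using sum_list_remove_node[OF positive removable] assms by simp
  have "bij_betw \<tau> (diagram \<alpha>) {1..sum_list \<alpha>} \<longleftrightarrow>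
      bij_betw \<tau> (diagram \<alpha> - {?x}) ({1..sum_list \<alpha>} - {1})"
    using notIn_Un_bij_betw3[of ?x "diagram \<alpha> - {?x}" \<tau> "{1..sum_list \<alpha>} - {1}"] one x n
    by (simp add: insert_absorb insert_Diff_if)
  also have "{1..sum_list \<alpha>} - {1} = Suc ` {1..sum_list \<beta>}"
    unfolding n by (auto simp: image_iff)
  also have "bij_betw \<tau> (diagram \<alpha> - {?x}) (Suc ` {1..sum_list \<beta>}) \<longleftrightarrow>
      bij_betw (\<tau> \<circ> ?s) (diagram \<beta>) (Suc ` {1..sum_list \<beta>})"
    by (rule bij_betw_comp_iff) (auto simp: bij_betw_def inj_on_def image_diagram)
  also have "\<dots> \<longleftrightarrow> bij_betw (Suc \<circ> \<sigma>) (diagram \<beta>) (Suc ` {1..sum_list \<beta>})"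
    by (rule bij_betw_cong) (auto simp: shifted)
  also have "\<dots> \<longleftrightarrow> bij_betw \<sigma> (diagram \<beta>) {1..sum_list \<beta>}"
    by (simp only: bij_betw_def image_comp[symmetric] inj_image_eq_iff[OF inj_Suc] inj_on_def
        comp_apply nat.inject)
  finally show ?thesis .
qed

lemma srct_shrink:
  assumes \<tau>: "\<tau> \<in> srct \<alpha>" and "0 < sum_list \<alpha>"
  shows "\<sigma> \<in> srct \<beta>"
proof (rule srctI)
  show "bij_betw \<sigma> (diagram \<beta>) {1..sum_list \<beta>}"
    using bij_iff[OF assms(2)] srct_bij[OF \<tau>] by simp
  fix r j j' assume *: "(r, j) \<in> diagram \<beta>" "(r, j') \<in> diagram \<beta>" "j < j'"
  then have "\<tau> (r + d, j') < \<tau> (r + d, j)"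
    using cell_iff by (intro srct_row_decreasing[OF \<tau>]) simp_all
  with * shifted show "\<sigma> (r, j') < \<sigma> (r, j)" by simp
next
  fix r r' assume *: "(r, 1) \<in> diagram \<beta>" "(r', 1) \<in> diagram \<beta>" "r < r'"
  then have "\<tau> (r + d, 1) < \<tau> (r' + d, 1)"
    using cell_iff by (intro srct_first_column[OF \<tau>]) simp_all
  with * shifted show "\<sigma> (r, 1) < \<sigma> (r', 1)" by simp
next
  fix r j k
  assume *: "r < j" "(r, k) \<in> diagram \<beta>" "(j, k + 1) \<in> diagram \<beta>" "\<sigma> (j, k + 1) < \<sigma> (r, k)"
  have "(r + d, k + 1) \<in> diagram \<alpha> \<and> \<tau> (j + d, k + 1) < \<tau> (r + d, k + 1)"
    using * cell_iff shifted by (intro srct_triple[OF \<tau>]) simp_all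
  \<comment> \<open>The cell supplied by the triple rule has an entry larger than another entry that
    is at least 1. So it does not carry the 1 and survives the removal.\<close>
  moreover from this one have "(r + d, k + 1) \<noteq> (i, part \<alpha> i)"
    using shifted[OF *(3)] by auto
  ultimately have "(r, k + 1) \<in> diagram \<beta>" "\<tau> (j + d, k + 1) < \<tau> (r + d, k + 1)"
    using cell_iff[of r "k + 1"] cell_iff[of r k] *(2) by simp_all
  with shifted[OF *(3)] shifted[of r "k + 1"]
  show "(r, k + 1) \<in> diagram \<beta> \<and> \<sigma> (j, k + 1) < \<sigma> (r, k + 1)" by simp
qed (rule outside')

text \<open>All old entries become at least 2, so comparisons with the new 1 have a known outcome.
  What remains is to see that the new cell is the last of its row, that in column 1 it is the
  topmost cell, and that the triple rule holds around it.\<close>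

lemma srct_extend:
  assumes \<sigma>: "\<sigma> \<in> srct \<beta>" and "0 < sum_list \<alpha>"
  shows "\<tau> \<in> srct \<alpha>"
proof -
  have bij: "bij_betw \<tau> (diagram \<alpha>) {1..sum_list \<alpha>}"
    using bij_iff[OF assms(2)] srct_bij[OF \<sigma>] by simp
  have ge1: "1 \<le> \<tau> c" if "c \<in> diagram \<alpha>" for c
    using bij_betwE[OF bij] that by auto
  have ge2: "2 \<le> \<tau> (r, c)" if rc: "(r, c) \<in> diagram \<alpha>" "(r, c) \<noteq> (i, part \<alpha> i)" for r c
  proof -
    obtain r' where "r = r' + d" "(r', c) \<in> diagram \<beta>" by (rule cellE[OF rc])
    with shifted[of r' c] srct_zero_iff[OF \<sigma>, of "(r', c)"] show ?thesis by simp
  qed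
  show ?thesis
  proof (rule srctI[OF bij outside])
    fix r j j' assume *: "(r, j) \<in> diagram \<alpha>" "(r, j') \<in> diagram \<alpha>" "j < j'"
    then have j: "(r, j) \<noteq> (i, part \<alpha> i)" by (auto simp: diagram_def)
    show "\<tau> (r, j') < \<tau> (r, j)"
    proof (cases "(r, j') = (i, part \<alpha> i)")
      case True
      then show ?thesis using ge2[OF *(1) j] one by simp
    next
      case False
      obtain r' where r': "r = r' + d" "(r', j) \<in> diagram \<beta>" by (rule cellE[OF *(1) j])
      obtain r'' where "r = r'' + d" "(r'', j') \<in> diagram \<beta>" by (rule cellE[OF *(2) False])
      with r' have "(r', j') \<in> diagram \<beta>" by simp
      from srct_row_decreasing[OF \<sigma> r'(2) this *(3)] shifted[OF this] shifted[OF r'(2)]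
      show ?thesis by (simp add: r'(1))
    qed
  next
    fix r r' assume *: "(r, 1) \<in> diagram \<alpha>" "(r', 1) \<in> diagram \<alpha>" "r < r'"
    \<comment> \<open>In column 1 the removed cell would be a part equal to 1 and hence lie in row
      1, but \<open>r'\<close> has the row \<open>r\<close> above it.\<close>
    have r': "(r', 1) \<noteq> (i, part \<alpha> i)"
      using part_one_removable[OF removable] *(1,3) by (auto simp: diagram_def)
    show "\<tau> (r, 1) < \<tau> (r', 1)"
    proof (cases "(r, 1) = (i, part \<alpha> i)")
      case True
      then show ?thesis using ge2[OF *(2) r'] one by simp
    next
      case False
      obtain s where s: "r = s + d" "(s, 1) \<in> diagram \<beta>" by (rule cellE[OF *(1) False])
      obtain s' where s': "r' = s' + d" "(s', 1) \<in> diagram \<beta>" by (rule cellE[OF *(2) r'])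
      have "s < s'" using s s' *(3) by simp
      from srct_first_column[OF \<sigma> s(2) s'(2) this] shifted[OF s(2)] shifted[OF s'(2)]
      show ?thesis by (simp add: s(1) s'(1))
    qed
  next
    fix r j k
    assume *: "r < j" "(r, k) \<in> diagram \<alpha>" "(j, k + 1) \<in> diagram \<alpha>" "\<tau> (j, k + 1) < \<tau> (r, k)"
    have rk: "(r, k) \<noteq> (i, part \<alpha> i)"
    proof
      assume "(r, k) = (i, part \<alpha> i)"
      with one ge1[OF *(3)] *(4) show False by simp
    qed
    obtain s where s: "r = s + d" "(s, k) \<in> diagram \<beta>" by (rule cellE[OF *(2) rk])
    show "(r, k + 1) \<in> diagram \<alpha> \<and> \<tau> (j, k + 1) < \<tau> (r, k + 1)"
    proof (cases "(j, k + 1) = (i, part \<alpha> i)")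
      case True
      \<comment> \<open>With the small entry 1 at (j, k + 1), the triple rule can fail only if row
        \<open>r\<close> stops at column \<open>k\<close>, that is, has length
        \<open>part \<alpha> i - 1\<close>. Removability forbids exactly this.\<close>
      then have "part \<alpha> r \<noteq> k"
        using removable *(1,2) by (auto simp: has_removable_node_def diagram_def)
      with *(2) have D: "(r, k + 1) \<in> diagram \<alpha>" by (simp add: diagram_def)
      from True *(1) have "(r, k + 1) \<noteq> (i, part \<alpha> i)" by simp
      from ge2[OF D this] True one D show ?thesis by simp
    next
      case False
      obtain t where t: "j = t + d" "(t, k + 1) \<in> diagram \<beta>" by (rule cellE[OF *(3) False])
      have "s < t" "\<sigma> (t, k + 1) < \<sigma> (s, k)"
        using s(1) t(1) *(1,4) shifted[OF s(2)] shifted[OF t(2)] by simp_all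
      from srct_triple[OF \<sigma> this(1) s(2) t(2) this(2)]
      have u: "(s, k + 1) \<in> diagram \<beta>" "\<sigma> (t, k + 1) < \<sigma> (s, k + 1)" by simp_all
      with shifted[OF t(2)] shifted[OF u(1)] cell_iff[of s "k + 1"]
      show ?thesis by (simp add: s(1) t(1))
    qed
  qed
qed

end

text \<open>The shape is not an argument, so one function serves all shapes. In a tableau,
  \<open>\<tau> (1, 1) = 1\<close> means that the first row is the single entry 1, which is when the
  rows move up. Truncated subtraction sends both the entry 1 and the filler 0 to 0, so the removed
  cell joins the outside.\<close>

definition strip :: "filling \<Rightarrow> filling" where
  "strip \<tau> = (\<lambda>(r, c). if r = 0 then 0 else \<tau> (r + (if \<tau> (1, 1) = 1 then 1 else 0), c) - 1)"

lemma strip_row_shift: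
  assumes "\<forall>a\<in>set \<alpha>. 0 < a" "has_removable_node \<alpha> i" "\<tau> (i, part \<alpha> i) = 1" "inj_entries \<tau>"
  shows "strip \<tau> (r, c) = (if r = 0 then 0 else \<tau> (r + row_shift \<alpha> i, c) - 1)"
proof -
  have "\<tau> (1, 1) = 1 \<longleftrightarrow> part \<alpha> i = 1"
  proof
    assume "\<tau> (1, 1) = 1"
    from inj_entries_unique[OF assms(4,3) this zero_less_one] show "part \<alpha> i = 1" by (metis prod.inject)
  next
    assume "part \<alpha> i = 1"
    with part_one_removable[OF assms(2)] assms(3) show "\<tau> (1, 1) = 1" by simp
  qed
  then show ?thesis by (simp add: strip_def row_shift_def)
qed

lemma node_removal_strip:
  assumes "\<forall>a\<in>set \<alpha>. 0 < a" "has_removable_node \<alpha> i" "\<tau> \<in> srct \<alpha>" "\<tau> (i, part \<alpha> i) = 1"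
  shows "node_removal \<alpha> i \<tau> (strip \<tau>)"
proof
  note zero_iff = srct_zero_iff[OF assms(3)]
  note st = strip_row_shift[OF assms(1,2,4) srct_inj_entries[OF assms(3)]]
  note cell_iff = diagram_remove_node[OF assms(1,2)]
  fix r c assume "(r, c) \<in> diagram (remove_node \<alpha> i)"
  then show "\<tau> (r + row_shift \<alpha> i, c) = Suc (strip \<tau> (r, c))"
    using zero_iff[of "(r + row_shift \<alpha> i, c)"] cell_iff[of r c] by (simp add: st)
next
  note zero_iff = srct_zero_iff[OF assms(3)]
  note st = strip_row_shift[OF assms(1,2,4) srct_inj_entries[OF assms(3)]]
  note cell_iff = diagram_remove_node[OF assms(1,2)]
  fix p assume p: "p \<notin> diagram (remove_node \<alpha> i)"
  obtain r c where rc: "p = (r, c)" by (rule prod.exhaust)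
  have "r = 0 \<or> \<tau> (r + row_shift \<alpha> i, c) = 0 \<or> (r + row_shift \<alpha> i, c) = (i, part \<alpha> i)"
    using p rc zero_iff[of "(r + row_shift \<alpha> i, c)"] cell_iff[of r c] by auto
  then show "strip \<tau> p = 0" unfolding rc st using assms(4) by auto
qed (use assms srct_zero_iff[OF assms(3)] in simp_all)

lemma strip_srct:
  assumes "\<forall>a\<in>set \<alpha>. 0 < a" "has_removable_node \<alpha> i" "\<tau> \<in> srct \<alpha>" "\<tau> (i, part \<alpha> i) = 1"
    "0 < sum_list \<alpha>"
  shows "strip \<tau> \<in> srct (remove_node \<alpha> i)"
  by (rule node_removal.srct_shrink[OF node_removal_strip[OF assms(1-4)] assms(3,5)])

lemma srct_one_removable:
  assumes "\<forall>a\<in>set \<alpha>. 0 < a" "\<tau> \<in> srct \<alpha>" "0 < sum_list \<alpha>"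
  obtains i where "has_removable_node \<alpha> i" "\<tau> (i, part \<alpha> i) = 1"
proof -
  have "1 \<le> sum_list \<alpha>" using assms(3) by simp
  then obtain p where p: "\<tau> p = 1" by (rule srct_entry[OF assms(2) order_refl])
  then obtain i where "has_removable_node \<alpha> i" "p = (i, part \<alpha> i)"
    by (rule entry_one_removable[OF assms(2,1)])
  with p that show ?thesis by simp
qed

text \<open>The common stripped filling has only one shape, and the shape determines the removed
  node. So both tableaux carry their 1 in the same cell, and their other entries are recovered from
  the stripped filling.\<close>

lemma strip_inj:
  assumes "\<forall>a\<in>set \<alpha>. 0 < a" "0 < sum_list \<alpha>"
  shows "inj_on strip (srct \<alpha>)"
proof (rule inj_onI)
  fix \<tau> \<tau>' assume \<tau>: "\<tau> \<in> srct \<alpha>" "\<tau>' \<in> srct \<alpha>" and eq: "strip \<tau> = strip \<tau>'"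
  obtain i where i: "has_removable_node \<alpha> i" "\<tau> (i, part \<alpha> i) = 1"
    by (rule srct_one_removable[OF assms(1) \<tau>(1) assms(2)])
  obtain j where j: "has_removable_node \<alpha> j" "\<tau>' (j, part \<alpha> j) = 1"
    by (rule srct_one_removable[OF assms(1) \<tau>(2) assms(2)])
  have "remove_node \<alpha> i = remove_node \<alpha> j"
    using strip_srct[OF assms(1) i(1) \<tau>(1) i(2) assms(2)]
      strip_srct[OF assms(1) j(1) \<tau>(2) j(2) assms(2)] unfolding eq
    by (rule srct_shape_unique[OF remove_node_positive remove_node_positive])
  then have ij: "i = j" by (rule remove_node_inj[OF assms(1) i(1) j(1)])
  interpret T: node_removal \<alpha> i \<tau> "strip \<tau>" by (rule node_removal_strip[OF assms(1) i(1) \<tau>(1) i(2)])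
  interpret T': node_removal \<alpha> i \<tau>' "strip \<tau>"
    unfolding eq by (rule node_removal_strip[OF assms(1) i(1) \<tau>(2)]) (use ij j in simp)
  show "\<tau> = \<tau>'"
  proof
    fix p :: "nat \<times> nat"
    obtain r c where p: "p = (r, c)" by (rule prod.exhaust)
    consider "p \<notin> diagram \<alpha>" | "p = (i, part \<alpha> i)" | "(r, c) \<in> diagram \<alpha>" "(r, c) \<noteq> (i, part \<alpha> i)"
      unfolding p by metis
    then show "\<tau> p = \<tau>' p"
    proof cases
      case 3
      then obtain r' where "r = r' + T.d" "(r', c) \<in> diagram T.\<beta>" by (rule T.cellE)
      with T.shifted[of r' c] T'.shifted[of r' c] p show ?thesis by simp
    next
      case 1
      show ?thesis by (simp only: T.outside[OF 1] T'.outside[OF 1])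
    qed (simp only: T.one T'.one)
  qed
qed

lemma strip_surj:
  assumes "\<forall>a\<in>set \<alpha>. 0 < a" "0 < sum_list \<alpha>" "has_removable_node \<alpha> i"
    "\<sigma> \<in> srct (remove_node \<alpha> i)"
  shows "\<sigma> \<in> strip ` srct \<alpha>"
proof -
  let ?d = "row_shift \<alpha> i"
  note cell_iff = diagram_remove_node[OF assms(1,3)]
  \<comment> \<open>The inverse construction: 1 goes into the removed cell, every other entry is
    raised by one, and \<open>r - ?d\<close> undoes the move of the rows.\<close>
  define \<tau> :: filling where "\<tau> = (\<lambda>(r, c). if (r, c) = (i, part \<alpha> i) then 1
    else if (r, c) \<in> diagram \<alpha> then Suc (\<sigma> (r - ?d, c)) else 0)"
  interpret node_removal \<alpha> i \<tau> \<sigma>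
  proof
    fix p assume p: "p \<notin> diagram \<alpha>"
    with removable_cell[OF assms(1,3)] show "\<tau> p = 0" unfolding \<tau>_def by (auto split: prod.split)
  next
    fix r c assume "(r, c) \<in> diagram (remove_node \<alpha> i)"
    then show "\<tau> (r + ?d, c) = Suc (\<sigma> (r, c))" using cell_iff[of r c] by (auto simp: \<tau>_def)
  qed (use assms srct_zero_iff[OF assms(4)] in \<open>simp_all add: \<tau>_def\<close>)
  have \<tau>: "\<tau> \<in> srct \<alpha>" by (rule srct_extend[OF assms(4,2)])
  \<comment> \<open>Now \<open>\<sigma>\<close> and \<open>strip \<tau>\<close> satisfy the same
    conditions relative to \<open>\<tau>\<close>, and these determine the smaller filling.\<close>
  interpret S: node_removal \<alpha> i \<tau> "strip \<tau>"
    by (rule node_removal_strip[OF assms(1,3) \<tau> one])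
  have "\<sigma> = strip \<tau>"
  proof
    fix p :: "nat \<times> nat"
    obtain r c where p: "p = (r, c)" by (rule prod.exhaust)
    show "\<sigma> p = strip \<tau> p"
      using shifted[of r c] S.shifted[of r c] outside'[of p] S.outside'[of p] p
      by (cases "p \<in> diagram \<beta>") simp_all
  qed
  with \<tau> show ?thesis by (simp only: imageI)
qed

lemma strip_image:
  assumes "\<forall>a\<in>set \<alpha>. 0 < a" "0 < sum_list \<alpha>"
  shows "strip ` srct \<alpha> = (\<Union>\<beta>\<in>node_removals \<alpha>. srct \<beta>)"
proof (intro equalityI subsetI)
  fix \<sigma> assume "\<sigma> \<in> strip ` srct \<alpha>"
  then obtain \<tau> where \<tau>: "\<tau> \<in> srct \<alpha>" "\<sigma> = strip \<tau>" by (rule imageE)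
  obtain i where "has_removable_node \<alpha> i" "\<tau> (i, part \<alpha> i) = 1"
    by (rule srct_one_removable[OF assms(1) \<tau>(1) assms(2)])
  with \<tau> strip_srct[OF assms(1) _ \<tau>(1) _ assms(2)] have "has_removable_node \<alpha> i"
    "\<sigma> \<in> srct (remove_node \<alpha> i)" by simp_all
  then show "\<sigma> \<in> (\<Union>\<beta>\<in>node_removals \<alpha>. srct \<beta>)" unfolding node_removals_def by (intro UN_I) auto
next
  fix \<sigma> assume "\<sigma> \<in> (\<Union>\<beta>\<in>node_removals \<alpha>. srct \<beta>)"
  then obtain i where "has_removable_node \<alpha> i" "\<sigma> \<in> srct (remove_node \<alpha> i)"
    unfolding node_removals_def by (elim UN_E) auto
  then show "\<sigma> \<in> strip ` srct \<alpha>" by (rule strip_surj[OF assms])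
qed


section \<open>Descents, attacks and exchanges under stripping\<close>

lemma (in node_removal) cell_entry:
  assumes "1 \<le> k" "\<tau> (r, c) = Suc k"
  obtains r' where "r = r' + d" "\<sigma> (r', c) = k"
proof -
  have rc: "(r, c) \<in> diagram \<alpha>" "(r, c) \<noteq> (i, part \<alpha> i)"
    using outside[of "(r, c)"] one assms
    by (metis nat.distinct(1), metis One_nat_def Suc_inject not_one_le_zero)
  obtain r' where "r = r' + d" "(r', c) \<in> diagram \<beta>" by (rule cellE[OF rc])
  with shifted[of r' c] assms(2) that[of r'] show ?thesis by simp
qed

lemma (in node_removal) shifted_entry:
  assumes "1 \<le> k" "\<sigma> (r, c) = k"
  shows "\<tau> (r + d, c) = Suc k"
proof -
  have "(r, c) \<in> diagram \<beta>" using outside'[of "(r, c)"] assms by (cases "(r, c) \<in> diagram \<beta>") simp_all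
  with shifted[of r c] assms(2) show ?thesis by simp
qed

text \<open>Stripping keeps the column of every surviving entry, and \<open>1 \<le> k\<close>
  ensures that neither of the two entries is the deleted one.\<close>

lemma (in node_removal) Des_shift:
  assumes "1 \<le> k"
  shows "Suc k \<in> Des \<tau> \<longleftrightarrow> k \<in> Des \<sigma>"
proof
  assume "Suc k \<in> Des \<tau>"
  then obtain r c r' c' where *: "\<tau> (r, c) = Suc k" "\<tau> (r', c') = Suc (Suc k)" "c \<le> c'"
    unfolding Des_def mem_Collect_eq Suc_eq_plus1 by (elim exE conjE)
  obtain s where "\<sigma> (s, c) = k" by (rule cell_entry[OF assms *(1)])
  moreover obtain s' where "\<sigma> (s', c') = Suc k" by (rule cell_entry[OF _ *(2)]) simp_all
  ultimately show "k \<in> Des \<sigma>"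
    unfolding Des_def mem_Collect_eq Suc_eq_plus1 using *(3) assms by (intro conjI exI)
next
  assume "k \<in> Des \<sigma>"
  then obtain r c r' c' where *: "\<sigma> (r, c) = k" "\<sigma> (r', c') = Suc k" "c \<le> c'"
    unfolding Des_def mem_Collect_eq Suc_eq_plus1 by (elim exE conjE)
  have "\<tau> (r + d, c) = Suc k" "\<tau> (r' + d, c') = Suc (Suc k)"
    by (rule shifted_entry, use assms * in simp_all)+
  then show "Suc k \<in> Des \<tau>"
    unfolding Des_def mem_Collect_eq Suc_eq_plus1 using *(3) by (intro conjI exI) simp_all
qed

text \<open>All rows move by the same amount, so the relative order of two rows is kept along with
  the columns.\<close>

lemma (in node_removal) attacking_shift:
  assumes "1 \<le> k"
  shows "attacking \<tau> (Suc k) \<longleftrightarrow> attacking \<sigma> k"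
proof
  assume "attacking \<tau> (Suc k)"
  then obtain r c r' c' where *: "\<tau> (r, c) = Suc k" "\<tau> (r', c') = Suc (Suc k)"
    "c = c' \<or> (c' = c + 1 \<and> r < r')"
    unfolding attacking_def Suc_eq_plus1 by (elim exE conjE)
  obtain s where s: "r = s + d" "\<sigma> (s, c) = k" by (rule cell_entry[OF assms *(1)])
  obtain s' where s': "r' = s' + d" "\<sigma> (s', c') = Suc k" by (rule cell_entry[OF _ *(2)]) simp_all
  have "c = c' \<or> (c' = c + 1 \<and> s < s')" using *(3) s(1) s'(1) by simp
  with s(2) s'(2) show "attacking \<sigma> k"
    unfolding attacking_def Suc_eq_plus1 using assms by (intro conjI exI)
next
  assume "attacking \<sigma> k"
  then obtain r c r' c' where *: "\<sigma> (r, c) = k" "\<sigma> (r', c') = Suc k"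
    "c = c' \<or> (c' = c + 1 \<and> r < r')"
    unfolding attacking_def Suc_eq_plus1 by (elim exE conjE)
  have "\<tau> (r + d, c) = Suc k" "\<tau> (r' + d, c') = Suc (Suc k)"
    by (rule shifted_entry, use assms * in simp_all)+
  moreover have "c = c' \<or> (c' = c + 1 \<and> r + d < r' + d)" using *(3) by simp
  moreover have "1 \<le> Suc k" by simp
  ultimately show "attacking \<tau> (Suc k)"
    unfolding attacking_def Suc_eq_plus1 by (intro conjI exI)
qed

text \<open>For \<open>1 \<le> k\<close> the exchange of k + 1 and k + 2 leaves the entry 1 alone,
  and with it the test that decides whether rows move.\<close>

lemma strip_swap_entries:
  assumes "1 \<le> k"
  shows "strip (swap_entries (Suc k) \<tau>) = swap_entries k (strip \<tau>)"
proof -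
  have "swap_entries (Suc k) \<tau> (1, 1) = 1 \<longleftrightarrow> \<tau> (1, 1) = 1"
    using assms by (simp add: swap_entries_apply)
  moreover have "swap_entries (Suc k) \<tau> p - 1 = (if \<tau> p - 1 = k then Suc k
      else if \<tau> p - 1 = Suc k then k else \<tau> p - 1)" for p
    using assms unfolding swap_entries_apply by (simp only: split: if_split) arith
  ultimately show ?thesis
    using assms by (intro ext) (simp add: strip_def swap_entries_apply[of k] split: prod.split)
qed

section \<open>Stripping on linear combinations, and splitting by shape\<close>

definition strip_lin :: "(filling \<Rightarrow>\<^sub>0 complex) \<Rightarrow> (filling \<Rightarrow>\<^sub>0 complex)" where
  "strip_lin = linear_extension (\<lambda>\<tau>. Poly_Mapping.single (strip \<tau>) 1)"

lemma complex_linear_strip_lin: "complex_linear strip_lin"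
  unfolding strip_lin_def by (rule complex_linear_linear_extension)

lemma strip_lin_single [simp]:
  "strip_lin (Poly_Mapping.single \<tau> 1) = Poly_Mapping.single (strip \<tau>) 1"
  by (simp add: strip_lin_def)

lemma pi_op_strip:
  assumes "\<forall>a\<in>set \<alpha>. 0 < a" "0 < sum_list \<alpha>" "\<tau> \<in> srct \<alpha>" "1 \<le> k"
  shows "pi_op k (strip \<tau>) = strip_lin (pi_op (Suc k) \<tau>)"
proof -
  obtain i where i: "has_removable_node \<alpha> i" "\<tau> (i, part \<alpha> i) = 1"
    by (rule srct_one_removable[OF assms(1,3,2)])
  interpret node_removal \<alpha> i \<tau> "strip \<tau>"
    by (rule node_removal_strip[OF assms(1) i(1) assms(3) i(2)])
  show ?thesis
    unfolding pi_op_def Des_shift[OF assms(4)] attacking_shift[OF assms(4)]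
    by (simp add: strip_swap_entries[OF assms(4)] complex_linear_zero[OF complex_linear_strip_lin])
qed

lemma strip_lin_pi:
  assumes "\<forall>a\<in>set \<alpha>. 0 < a" "0 < sum_list \<alpha>" "Poly_Mapping.keys v \<subseteq> srct \<alpha>" "1 \<le> k"
  shows "strip_lin (pi_lin (Suc k) v) = pi_lin k (strip_lin v)"
proof (rule complex_linear_eqI[OF _ _ assms(3)])
  show "complex_linear (\<lambda>v. strip_lin (pi_lin (Suc k) v))" "complex_linear (\<lambda>v. pi_lin k (strip_lin v))"
    by (rule complex_linear_comp[OF complex_linear_strip_lin complex_linear_linear_extension])
      (rule complex_linear_comp[OF complex_linear_linear_extension complex_linear_strip_lin])
  fix \<tau> assume "\<tau> \<in> srct \<alpha>"
  then show "strip_lin (pi_lin (Suc k) (Poly_Mapping.single \<tau> 1)) =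
      pi_lin k (strip_lin (Poly_Mapping.single \<tau> 1))"
    by (simp add: pi_op_strip[OF assms(1,2) _ assms(4)])
qed

lemma keys_strip_lin:
  assumes "Poly_Mapping.keys v \<subseteq> A"
  shows "Poly_Mapping.keys (strip_lin v) \<subseteq> strip ` A"
  unfolding strip_lin_def
  by (rule keys_linear_extension) (simp add: imageI subsetD[OF assms])

definition proj :: "nat list \<Rightarrow> (filling \<Rightarrow>\<^sub>0 complex) \<Rightarrow> (filling \<Rightarrow>\<^sub>0 complex)" where
  "proj \<beta> = linear_extension (\<lambda>\<sigma>. if \<sigma> \<in> srct \<beta> then Poly_Mapping.single \<sigma> 1 else 0)"

lemma complex_linear_proj: "complex_linear (proj \<beta>)"
  unfolding proj_def by (rule complex_linear_linear_extension)

lemma proj_single [simp]: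
  "proj \<beta> (Poly_Mapping.single \<sigma> 1) = (if \<sigma> \<in> srct \<beta> then Poly_Mapping.single \<sigma> 1 else 0)"
  by (simp add: proj_def)

lemma keys_proj: "Poly_Mapping.keys (proj \<beta> v) \<subseteq> srct \<beta>"
  unfolding proj_def by (rule keys_linear_extension) simp

lemma complex_linear_const_zero: "complex_linear (\<lambda>v. 0)"
  by (rule complex_linearI) simp_all

lemma proj_same:
  assumes "Poly_Mapping.keys v \<subseteq> srct \<beta>"
  shows "proj \<beta> v = v"
  by (rule complex_linear_eqI[OF complex_linear_proj complex_linear_id assms]) simp

lemma proj_other:
  assumes "Poly_Mapping.keys v \<subseteq> srct \<gamma>" "\<forall>a\<in>set \<beta>. 0 < a" "\<forall>a\<in>set \<gamma>. 0 < a" "\<beta> \<noteq> \<gamma>"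
  shows "proj \<beta> v = 0"
proof (rule complex_linear_eqI[OF complex_linear_proj complex_linear_const_zero assms(1)])
  fix \<sigma> assume "\<sigma> \<in> srct \<gamma>"
  then have "\<sigma> \<notin> srct \<beta>" using srct_shape_unique[OF assms(2,3)] assms(4) by iprover
  then show "proj \<beta> (Poly_Mapping.single \<sigma> 1) = 0" by simp
qed

text \<open>Each operator preserves the span of one shape. On the sum of these spans it is therefore
  block diagonal and commutes with the projection onto a block.\<close>

lemma proj_pi:
  assumes "\<forall>\<gamma>\<in>B. \<forall>a\<in>set \<gamma>. 0 < a" "\<beta> \<in> B" "Poly_Mapping.keys v \<subseteq> (\<Union>\<gamma>\<in>B. srct \<gamma>)"
  shows "proj \<beta> (pi_lin k v) = pi_lin k (proj \<beta> v)"
proof (rule complex_linear_eqI[OF _ _ assms(3)])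
  show "complex_linear (\<lambda>v. proj \<beta> (pi_lin k v))" "complex_linear (\<lambda>v. pi_lin k (proj \<beta> v))"
    by (rule complex_linear_comp[OF complex_linear_proj complex_linear_linear_extension])
      (rule complex_linear_comp[OF complex_linear_linear_extension complex_linear_proj])
  fix \<sigma> assume "\<sigma> \<in> (\<Union>\<gamma>\<in>B. srct \<gamma>)"
  then obtain \<gamma> where \<gamma>: "\<gamma> \<in> B" "\<sigma> \<in> srct \<gamma>" by (rule UN_E)
  have sub: "Poly_Mapping.keys (Poly_Mapping.single \<sigma> (1::complex)) \<subseteq> srct \<gamma>"
    using \<gamma>(2) by simp
  have sub': "Poly_Mapping.keys (pi_lin k (Poly_Mapping.single \<sigma> 1)) \<subseteq> srct \<gamma>"
    using keys_pi_op[OF \<gamma>(2)] by simp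
  show "proj \<beta> (pi_lin k (Poly_Mapping.single \<sigma> 1)) = pi_lin k (proj \<beta> (Poly_Mapping.single \<sigma> 1))"
  proof (cases "\<beta> = \<gamma>")
    case True
    then show ?thesis by (simp only: proj_same[OF sub] proj_same[OF sub'])
  next
    case False
    have pos: "\<forall>a\<in>set \<beta>. 0 < a" "\<forall>a\<in>set \<gamma>. 0 < a" by (rule bspec[OF assms(1)], fact)+
    show ?thesis
      by (simp only: proj_other[OF sub pos False] proj_other[OF sub' pos False]
          complex_linear_zero[OF complex_linear_linear_extension])
  qed
qed

text \<open>Every tableau in the union has exactly one shape in \<open>B\<close>, so exactly one
  projection keeps it.\<close>

lemma sum_proj:
  assumes "finite B" "\<forall>\<gamma>\<in>B. \<forall>a\<in>set \<gamma>. 0 < a" "Poly_Mapping.keys v \<subseteq> (\<Union>\<gamma>\<in>B. srct \<gamma>)"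
  shows "(\<Sum>\<beta>\<in>B. proj \<beta> v) = v"
proof (rule complex_linear_eqI[OF _ complex_linear_id assms(3)])
  show "complex_linear (\<lambda>v. \<Sum>\<beta>\<in>B. proj \<beta> v)"
    by (rule complex_linearI) (simp_all add: complex_linear_add[OF complex_linear_proj]
        complex_linear_scale[OF complex_linear_proj] sum.distrib scale_sum)
  fix \<sigma> assume "\<sigma> \<in> (\<Union>\<gamma>\<in>B. srct \<gamma>)"
  then obtain \<gamma> where \<gamma>: "\<gamma> \<in> B" "\<sigma> \<in> srct \<gamma>" by (rule UN_E)
  have "proj \<beta> (Poly_Mapping.single \<sigma> 1) = (if \<beta> = \<gamma> then Poly_Mapping.single \<sigma> 1 else 0)"
    if \<beta>: "\<beta> \<in> B" for \<beta>
  proof -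
    have "\<sigma> \<in> srct \<beta> \<longleftrightarrow> \<beta> = \<gamma>"
      using srct_shape_unique[OF bspec[OF assms(2) \<beta>] bspec[OF assms(2) \<gamma>(1)] _ \<gamma>(2)] \<gamma>(2)
      by iprover
    then show ?thesis by simp
  qed
  then show "(\<Sum>\<beta>\<in>B. proj \<beta> (Poly_Mapping.single \<sigma> 1)) = Poly_Mapping.single \<sigma> 1"
    using assms(1) \<gamma>(1) by (simp add: sum.delta cong: sum.cong)
qed


section \<open>Direct sums and transport of module structure\<close>

lemma direct_sum_simps:
  "add (direct_sum I M) = (\<lambda>f g. \<lambda>i\<in>I. f i \<oplus>\<^bsub>M i\<^esub> g i)"
  "zero (direct_sum I M) = (\<lambda>i\<in>I. \<zero>\<^bsub>M i\<^esub>)"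
  "smult (direct_sum I M) = (\<lambda>a f. \<lambda>i\<in>I. a \<odot>\<^bsub>M i\<^esub> f i)"
  by (simp_all add: direct_sum_def)

lemma carrier_direct_sum:
  "finite I \<Longrightarrow> carrier (direct_sum I M) = (\<Pi>\<^sub>E i\<in>I. carrier (M i))"
  by (simp add: direct_sum_def)

lemma restrict_PiE: "(\<And>i. i \<in> I \<Longrightarrow> f i \<in> A i) \<Longrightarrow> restrict f I \<in> (\<Pi>\<^sub>E i\<in>I. A i)"
  by (rule restrict_PiE_iff[THEN iffD2]) (rule ballI)

lemma left_module_direct_sum:
  assumes "ring R" "finite I" and M: "\<And>i. i \<in> I \<Longrightarrow> left_module R (M i)"
  shows "left_module R (direct_sum I M)"
proof -
  note car = carrier_direct_sum[OF assms(2)]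
  note abelian = left_module.axioms(2)[OF M]
  note mem = PiE_mem[of _ I "\<lambda>i. carrier (M i)"]
  have sum_abelian: "abelian_group (direct_sum I M)"
  proof (rule abelian_groupI; unfold car direct_sum_simps)
    fix f g assume f: "f \<in> (\<Pi>\<^sub>E i\<in>I. carrier (M i))" and g: "g \<in> (\<Pi>\<^sub>E i\<in>I. carrier (M i))"
    show "(\<lambda>i\<in>I. f i \<oplus>\<^bsub>M i\<^esub> g i) \<in> (\<Pi>\<^sub>E i\<in>I. carrier (M i))"
      by (rule restrict_PiE)
        (rule abelian_monoid.a_closed[OF abelian_group.axioms(1)[OF abelian] mem[OF f] mem[OF g]])
    show "(\<lambda>i\<in>I. f i \<oplus>\<^bsub>M i\<^esub> g i) = (\<lambda>i\<in>I. g i \<oplus>\<^bsub>M i\<^esub> f i)"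
      by (rule restrict_ext)
        (rule abelian_monoid.a_comm[OF abelian_group.axioms(1)[OF abelian] mem[OF f] mem[OF g]])
    fix h assume h: "h \<in> (\<Pi>\<^sub>E i\<in>I. carrier (M i))"
    show "(\<lambda>i\<in>I. (\<lambda>i\<in>I. f i \<oplus>\<^bsub>M i\<^esub> g i) i \<oplus>\<^bsub>M i\<^esub> h i) =
        (\<lambda>i\<in>I. f i \<oplus>\<^bsub>M i\<^esub> (\<lambda>i\<in>I. g i \<oplus>\<^bsub>M i\<^esub> h i) i)"
      by (rule restrict_ext)
        (simp add: abelian_monoid.a_assoc[OF abelian_group.axioms(1)[OF abelian] mem[OF f] mem[OF g] mem[OF h]])
  next
    show "(\<lambda>i\<in>I. \<zero>\<^bsub>M i\<^esub>) \<in> (\<Pi>\<^sub>E i\<in>I. carrier (M i))"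
      by (rule restrict_PiE)
        (rule abelian_monoid.zero_closed[OF abelian_group.axioms(1)[OF abelian]])
  next
    fix f assume f: "f \<in> (\<Pi>\<^sub>E i\<in>I. carrier (M i))"
    have "(\<lambda>i\<in>I. (\<lambda>i\<in>I. \<zero>\<^bsub>M i\<^esub>) i \<oplus>\<^bsub>M i\<^esub> f i) = restrict f I"
      by (rule restrict_ext)
        (simp add: abelian_monoid.l_zero[OF abelian_group.axioms(1)[OF abelian] mem[OF f]])
    then show "(\<lambda>i\<in>I. (\<lambda>i\<in>I. \<zero>\<^bsub>M i\<^esub>) i \<oplus>\<^bsub>M i\<^esub> f i) = f"
      by (simp only: PiE_restrict[OF f])
    show "\<exists>g\<in>\<Pi>\<^sub>E i\<in>I. carrier (M i). (\<lambda>i\<in>I. g i \<oplus>\<^bsub>M i\<^esub> f i) = (\<lambda>i\<in>I. \<zero>\<^bsub>M i\<^esub>)"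
    proof
      show "(\<lambda>i\<in>I. \<ominus>\<^bsub>M i\<^esub> f i) \<in> (\<Pi>\<^sub>E i\<in>I. carrier (M i))"
        by (rule restrict_PiE) (rule abelian_group.a_inv_closed[OF abelian mem[OF f]])
      show "(\<lambda>i\<in>I. (\<lambda>i\<in>I. \<ominus>\<^bsub>M i\<^esub> f i) i \<oplus>\<^bsub>M i\<^esub> f i) = (\<lambda>i\<in>I. \<zero>\<^bsub>M i\<^esub>)"
        by (rule restrict_ext) (simp add: abelian_group.l_neg[OF abelian mem[OF f]])
    qed
  qed
  show ?thesis
  proof (intro left_module.intro left_module_axioms.intro assms(1) sum_abelian; unfold car direct_sum_simps)
    fix a f assume a: "a \<in> carrier R" and f: "f \<in> (\<Pi>\<^sub>E i\<in>I. carrier (M i))"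
    show "(\<lambda>i\<in>I. a \<odot>\<^bsub>M i\<^esub> f i) \<in> (\<Pi>\<^sub>E i\<in>I. carrier (M i))"
      by (rule restrict_PiE) (rule left_module.smult_closed[OF M a mem[OF f]])
    fix b assume b: "b \<in> carrier R"
    show "(\<lambda>i\<in>I. (a \<oplus>\<^bsub>R\<^esub> b) \<odot>\<^bsub>M i\<^esub> f i) =
        (\<lambda>i\<in>I. (\<lambda>i\<in>I. a \<odot>\<^bsub>M i\<^esub> f i) i \<oplus>\<^bsub>M i\<^esub> (\<lambda>i\<in>I. b \<odot>\<^bsub>M i\<^esub> f i) i)"
      by (rule restrict_ext) (simp add: left_module.smult_l_distr[OF M a b mem[OF f]])
    show "(\<lambda>i\<in>I. (a \<otimes>\<^bsub>R\<^esub> b) \<odot>\<^bsub>M i\<^esub> f i) =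
        (\<lambda>i\<in>I. a \<odot>\<^bsub>M i\<^esub> (\<lambda>i\<in>I. b \<odot>\<^bsub>M i\<^esub> f i) i)"
      by (rule restrict_ext) (simp add: left_module.smult_assoc[OF M a b mem[OF f]])
  next
    fix a f g assume a: "a \<in> carrier R" and f: "f \<in> (\<Pi>\<^sub>E i\<in>I. carrier (M i))"
      and g: "g \<in> (\<Pi>\<^sub>E i\<in>I. carrier (M i))"
    show "(\<lambda>i\<in>I. a \<odot>\<^bsub>M i\<^esub> (\<lambda>i\<in>I. f i \<oplus>\<^bsub>M i\<^esub> g i) i) =
        (\<lambda>i\<in>I. (\<lambda>i\<in>I. a \<odot>\<^bsub>M i\<^esub> f i) i \<oplus>\<^bsub>M i\<^esub> (\<lambda>i\<in>I. a \<odot>\<^bsub>M i\<^esub> g i) i)"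
      by (rule restrict_ext) (simp add: left_module.smult_r_distr[OF M a mem[OF f] mem[OF g]])
  next
    fix f assume f: "f \<in> (\<Pi>\<^sub>E i\<in>I. carrier (M i))"
    have "(\<lambda>i\<in>I. \<one>\<^bsub>R\<^esub> \<odot>\<^bsub>M i\<^esub> f i) = restrict f I"
      by (rule restrict_ext) (rule left_module.smult_one[OF M mem[OF f]])
    then show "(\<lambda>i\<in>I. \<one>\<^bsub>R\<^esub> \<odot>\<^bsub>M i\<^esub> f i) = f"
      by (simp only: PiE_restrict[OF f])
  qed
qed

text \<open>Each module axiom for \<open>M\<close> is an equation that becomes an axiom of
  \<open>N\<close> after applying \<open>\<phi>\<close>, and injectivity brings it back. The
  restricted module gets its axioms this way, from the direct sum, rather than from
  \<open>hecke_embedding\<close> as a ring homomorphism.\<close>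

lemma isomorphic_modules_transport:
  assumes N: "left_module R N" and "abelian_group M" and \<phi>: "\<phi> \<in> module_hom R M N"
    and bij: "bij_betw \<phi> (carrier M) (carrier N)"
    and closed: "\<And>a x. \<lbrakk>a \<in> carrier R; x \<in> carrier M\<rbrakk> \<Longrightarrow> a \<odot>\<^bsub>M\<^esub> x \<in> carrier M"
  shows "isomorphic_modules R M N"
proof -
  interpret N: left_module R N by (rule N)
  interpret M: abelian_group M by (rule assms(2))
  have add: "\<phi> (x \<oplus>\<^bsub>M\<^esub> y) = \<phi> x \<oplus>\<^bsub>N\<^esub> \<phi> y" if "x \<in> carrier M" "y \<in> carrier M" for x y
    using \<phi> that by (simp add: module_hom_def)
  have smult: "\<phi> (a \<odot>\<^bsub>M\<^esub> x) = a \<odot>\<^bsub>N\<^esub> \<phi> x" if "a \<in> carrier R" "x \<in> carrier M" for a x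
    using \<phi> that by (simp add: module_hom_def)
  have mem: "\<phi> x \<in> carrier N" if "x \<in> carrier M" for x
    using \<phi> that by (auto simp: module_hom_def)
  note inj = inj_onD[OF bij_betw_imp_inj_on[OF bij]]
  have "left_module R M"
  proof (intro left_module.intro left_module_axioms.intro N.R.ring_axioms assms(2) closed; assumption?)
    fix a b x assume "a \<in> carrier R" "b \<in> carrier R" "x \<in> carrier M"
    then show "(a \<oplus>\<^bsub>R\<^esub> b) \<odot>\<^bsub>M\<^esub> x = a \<odot>\<^bsub>M\<^esub> x \<oplus>\<^bsub>M\<^esub> b \<odot>\<^bsub>M\<^esub> x"
      and "(a \<otimes>\<^bsub>R\<^esub> b) \<odot>\<^bsub>M\<^esub> x = a \<odot>\<^bsub>M\<^esub> (b \<odot>\<^bsub>M\<^esub> x)"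
      by (intro inj; simp add: add smult mem closed N.smult_l_distr N.smult_assoc)+
  next
    fix a x y assume "a \<in> carrier R" "x \<in> carrier M" "y \<in> carrier M"
    then show "a \<odot>\<^bsub>M\<^esub> (x \<oplus>\<^bsub>M\<^esub> y) = a \<odot>\<^bsub>M\<^esub> x \<oplus>\<^bsub>M\<^esub> a \<odot>\<^bsub>M\<^esub> y"
      by (intro inj; simp add: add smult mem closed N.smult_r_distr)
  next
    fix x assume "x \<in> carrier M"
    then show "\<one>\<^bsub>R\<^esub> \<odot>\<^bsub>M\<^esub> x = x"
      by (intro inj; simp add: smult mem closed N.smult_one)
  qed
  with N \<phi> bij show ?thesis unfolding isomorphic_modules_def by (intro conjI bexI)
qed


section \<open>The branching rule\<close>

lemma finite_node_removals: "finite (node_removals \<alpha>)"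
proof (rule finite_subset)
  show "node_removals \<alpha> \<subseteq> remove_node \<alpha> ` {1..length \<alpha>}"
    unfolding node_removals_def has_removable_node_def by auto
qed simp

locale branching =
  fixes \<alpha> :: "nat list"
  assumes positive: "\<forall>a\<in>set \<alpha>. 0 < a" and nonempty: "0 < sum_list \<alpha>"
begin

abbreviation "B \<equiv> node_removals \<alpha>"

definition component :: "nat list \<Rightarrow> (filling \<Rightarrow>\<^sub>0 complex) \<Rightarrow> (filling \<Rightarrow>\<^sub>0 complex)" where
  "component \<beta> v = proj \<beta> (strip_lin v)"

lemma B_positive: "\<forall>\<gamma>\<in>B. \<forall>a\<in>set \<gamma>. 0 < a"
  unfolding node_removals_def using remove_node_positive by (intro ballI) auto

lemma B_sum_list: "\<beta> \<in> B \<Longrightarrow> sum_list \<beta> = sum_list \<alpha> - 1"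
  unfolding node_removals_def using sum_list_remove_node[OF positive] by auto

lemma complex_linear_component: "complex_linear (component \<beta>)"
  unfolding component_def by (rule complex_linear_comp[OF complex_linear_proj complex_linear_strip_lin])

lemma keys_component: "Poly_Mapping.keys (component \<beta> v) \<subseteq> srct \<beta>"
  unfolding component_def by (rule keys_proj)

lemma component_pi:
  assumes "\<beta> \<in> B" "Poly_Mapping.keys v \<subseteq> srct \<alpha>" "1 \<le> k"
  shows "component \<beta> (pi_lin (Suc k) v) = pi_lin k (component \<beta> v)"
proof -
  have "Poly_Mapping.keys (strip_lin v) \<subseteq> (\<Union>\<gamma>\<in>B. srct \<gamma>)"
    using keys_strip_lin[OF assms(2)] by (simp only: strip_image[OF positive nonempty])
  from proj_pi[OF B_positive assms(1) this] show ?thesis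
    by (simp only: component_def strip_lin_pi[OF positive nonempty assms(2,3)])
qed

lemma component_word_action:
  assumes "\<beta> \<in> B" "Poly_Mapping.keys v \<subseteq> srct \<alpha>" "\<forall>k\<in>set (letters w). 1 \<le> k"
  shows "component \<beta> (word_action (Word (map Suc (letters w))) v) = word_action w (component \<beta> v)"
proof -
  have "component \<beta> (word_action (Word (map Suc ks)) v) = word_action (Word ks) (component \<beta> v)"
    if "\<forall>k\<in>set ks. 1 \<le> k" for ks
    using that
  proof (induction ks)
    case (Cons k ks)
    have "component \<beta> (pi_lin (Suc k) (word_action (Word (map Suc ks)) v)) =
        pi_lin k (component \<beta> (word_action (Word (map Suc ks)) v))"
      using Cons.prems by (intro component_pi[OF assms(1) keys_word_action[OF assms(2)]]) simp
    with Cons show ?case by (simp add: word_action_def)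
  qed (simp add: word_action_def)
  from this[OF assms(3)] show ?thesis by simp
qed

lemma complex_linear_shift_letters: "complex_linear shift_letters"
  unfolding shift_letters_def by (rule complex_linear_linear_extension)

text \<open>The letters of \<open>f\<close> are at least 1, so the shifted ones are at least 2.
  Those operators do not move the entry 1, hence commute with removing it and with the splitting by
  shape.\<close>

lemma component_free_action:
  assumes "\<beta> \<in> B" "Poly_Mapping.keys v \<subseteq> srct \<alpha>" "f \<in> carrier (free_algebra m)"
  shows "component \<beta> (free_action (shift_letters f) v) = free_action f (component \<beta> v)"
proof (rule complex_linear_eqI[where f="\<lambda>f. component \<beta> (free_action (shift_letters f) v)"
      and g="\<lambda>f. free_action f (component \<beta> v)"])
  show "complex_linear (\<lambda>f. component \<beta> (free_action (shift_letters f) v))"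
    by (rule complex_linear_comp[OF complex_linear_component
          complex_linear_comp[OF complex_linear_free_action_left complex_linear_shift_letters]])
  show "complex_linear (\<lambda>f. free_action f (component \<beta> v))" by (rule complex_linear_free_action_left)
  show "Poly_Mapping.keys f \<subseteq> {w. set (letters w) \<subseteq> {1..<m}}"
    using assms(3) unfolding free_carrier_iff by (intro subsetI) simp
  fix w assume "w \<in> {w. set (letters w) \<subseteq> {1..<m}}"
  then have "\<forall>k\<in>set (letters w). 1 \<le> k" by auto
  from component_word_action[OF assms(1,2) this]
  show "component \<beta> (free_action (shift_letters (Poly_Mapping.single w 1)) v) =
      free_action (Poly_Mapping.single w 1) (component \<beta> v)"
    by (simp add: shift_letters_def)
qed

text \<open>Off the image of \<open>strip\<close>, the value of \<open>inv_into\<close> carries no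
  meaning; this is why the statements on supports and on \<open>strip_lin\<close> after
  \<open>unstrip_lin\<close> restrict the support to that image.\<close>

definition unstrip_lin :: "(filling \<Rightarrow>\<^sub>0 complex) \<Rightarrow> (filling \<Rightarrow>\<^sub>0 complex)" where
  "unstrip_lin = linear_extension (\<lambda>\<sigma>. Poly_Mapping.single (inv_into (srct \<alpha>) strip \<sigma>) 1)"

lemma complex_linear_unstrip_lin: "complex_linear unstrip_lin"
  unfolding unstrip_lin_def by (rule complex_linear_linear_extension)

lemma unstrip_lin_single:
  "unstrip_lin (Poly_Mapping.single \<sigma> 1) = Poly_Mapping.single (inv_into (srct \<alpha>) strip \<sigma>) 1"
  by (simp add: unstrip_lin_def)

lemma unstrip_strip:
  assumes "Poly_Mapping.keys v \<subseteq> srct \<alpha>"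
  shows "unstrip_lin (strip_lin v) = v"
proof (rule complex_linear_eqI[OF _ complex_linear_id assms])
  show "complex_linear (\<lambda>v. unstrip_lin (strip_lin v))"
    by (rule complex_linear_comp[OF complex_linear_unstrip_lin complex_linear_strip_lin])
next
  fix \<tau> assume "\<tau> \<in> srct \<alpha>"
  from inv_into_f_f[OF strip_inj[OF positive nonempty] this]
  show "unstrip_lin (strip_lin (Poly_Mapping.single \<tau> 1)) = Poly_Mapping.single \<tau> 1"
    by (simp only: strip_lin_single unstrip_lin_single)
qed

lemma strip_unstrip:
  assumes "Poly_Mapping.keys u \<subseteq> strip ` srct \<alpha>"
  shows "strip_lin (unstrip_lin u) = u"
proof (rule complex_linear_eqI[OF _ complex_linear_id assms])
  show "complex_linear (\<lambda>v. strip_lin (unstrip_lin v))"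
    by (rule complex_linear_comp[OF complex_linear_strip_lin complex_linear_unstrip_lin])
next
  fix \<sigma> assume "\<sigma> \<in> strip ` srct \<alpha>"
  from f_inv_into_f[OF this]
  show "strip_lin (unstrip_lin (Poly_Mapping.single \<sigma> 1)) = Poly_Mapping.single \<sigma> 1"
    by (simp only: strip_lin_single unstrip_lin_single)
qed

lemma keys_unstrip_lin:
  assumes "Poly_Mapping.keys u \<subseteq> strip ` srct \<alpha>"
  shows "Poly_Mapping.keys (unstrip_lin u) \<subseteq> srct \<alpha>"
  unfolding unstrip_lin_def
proof (rule keys_linear_extension)
  fix \<sigma> assume "\<sigma> \<in> Poly_Mapping.keys u"
  from inv_into_into[OF subsetD[OF assms this]]
  show "Poly_Mapping.keys (Poly_Mapping.single (inv_into (srct \<alpha>) strip \<sigma>) (1::complex)) \<subseteq> srct \<alpha>"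
    by (simp only: keys_single one_neq_zero if_False insert_subset empty_subsetI simp_thms)
qed

lemma sum_component:
  assumes "Poly_Mapping.keys v \<subseteq> srct \<alpha>"
  shows "unstrip_lin (\<Sum>\<beta>\<in>B. component \<beta> v) = v"
proof -
  have "Poly_Mapping.keys (strip_lin v) \<subseteq> (\<Union>\<gamma>\<in>B. srct \<gamma>)"
    using keys_strip_lin[OF assms] by (simp only: strip_image[OF positive nonempty])
  from sum_proj[OF finite_node_removals B_positive this] unstrip_strip[OF assms]
  show ?thesis by (simp only: component_def)
qed

text \<open>The components of \<open>v\<close> add up to \<open>strip_lin v\<close>, from which
  \<open>v\<close> is recovered.\<close>

lemma component_inj:
  assumes "Poly_Mapping.keys u \<subseteq> srct \<alpha>" "Poly_Mapping.keys v \<subseteq> srct \<alpha>"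
    and "\<And>\<beta>. \<beta> \<in> B \<Longrightarrow> component \<beta> u = component \<beta> v"
  shows "u = v"
proof -
  have "(\<Sum>\<beta>\<in>B. component \<beta> u) = (\<Sum>\<beta>\<in>B. component \<beta> v)"
    by (rule sum.cong[OF refl assms(3)])
  from arg_cong[OF this, of unstrip_lin] show ?thesis
    by (simp only: sum_component[OF assms(1)] sum_component[OF assms(2)])
qed

lemma component_surj:
  assumes "\<And>\<beta>. \<beta> \<in> B \<Longrightarrow> Poly_Mapping.keys (g \<beta>) \<subseteq> srct \<beta>"
  shows "\<exists>v. Poly_Mapping.keys v \<subseteq> srct \<alpha> \<and> (\<forall>\<beta>\<in>B. component \<beta> v = g \<beta>)"
proof (intro exI conjI ballI)
  \<comment> \<open>Adding the prescribed components merges them without loss, since their supports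
    are disjoint. The witness is the unstripped sum, and the projection to \<open>\<beta>\<close>
    returns \<open>g \<beta>\<close>.\<close>
  let ?u = "\<Sum>\<gamma>\<in>B. g \<gamma>"
  have u: "Poly_Mapping.keys ?u \<subseteq> strip ` srct \<alpha>"
    unfolding strip_image[OF positive nonempty]
    by (rule keys_sum_subset) (rule order_trans, erule assms, erule UN_upper)
  show "Poly_Mapping.keys (unstrip_lin ?u) \<subseteq> srct \<alpha>"
    by (rule keys_unstrip_lin[OF u])
  fix \<beta> assume \<beta>: "\<beta> \<in> B"
  have "proj \<beta> (g \<gamma>) = (if \<beta> = \<gamma> then g \<gamma> else 0)" if \<gamma>: "\<gamma> \<in> B" for \<gamma>
  proof (cases "\<beta> = \<gamma>")
    case True
    then show ?thesis using proj_same[OF assms[OF \<gamma>]] by simp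
  next
    case False
    then show ?thesis
      using proj_other[OF assms[OF \<gamma>] bspec[OF B_positive \<beta>] bspec[OF B_positive \<gamma>]] by simp
  qed
  then have "(\<Sum>\<gamma>\<in>B. proj \<beta> (g \<gamma>)) = (\<Sum>\<gamma>\<in>B. if \<beta> = \<gamma> then g \<gamma> else 0)"
    by (rule sum.cong[OF refl])
  also have "\<dots> = g \<beta>" using finite_node_removals \<beta> by simp
  finally show "component \<beta> (unstrip_lin ?u) = g \<beta>"
    by (simp only: component_def strip_unstrip[OF u] complex_linear_sum[OF complex_linear_proj])
qed

text \<open>An element of the embedded coset is a member of the large ideal, which acts as zero,
  plus the shift of some \<open>g'\<close> in the small coset. To compare the shifts of
  \<open>g'\<close> and \<open>f\<close>, pass to components: there they act as \<open>g'\<close>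
  and \<open>f\<close> themselves, on modules of size \<open>sum_list \<alpha> - 1\<close>, where
  members of one coset act alike. Injectivity of the components brings the equality back.\<close>

lemma restricted_smult:
  assumes f: "f \<in> carrier (free_algebra (sum_list \<alpha> - 1))" and v: "Poly_Mapping.keys v \<subseteq> srct \<alpha>"
  shows "hecke_embedding (sum_list \<alpha>)
      (hecke_ideal (sum_list \<alpha> - 1) +>\<^bsub>free_algebra (sum_list \<alpha> - 1)\<^esub> f) \<odot>\<^bsub>\<^bold>S \<alpha>\<^esub> v =
    free_action (shift_letters f) v"
proof (rule smult_srct_module)
  let ?n = "sum_list \<alpha>"
  let ?X = "hecke_ideal (?n - 1) +>\<^bsub>free_algebra (?n - 1)\<^esub> f"
  interpret I: ideal "hecke_ideal ?n" "free_algebra ?n" by (rule ideal_hecke_ideal)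
  have mem: "g \<in> hecke_embedding ?n ?X \<longleftrightarrow>
      (\<exists>h\<in>hecke_ideal ?n. \<exists>g'\<in>?X. g = h + shift_letters g')" for g
    unfolding hecke_embedding_def set_add_def' by auto
  have "0 \<in> hecke_ideal ?n" using I.additive_subgroup_axioms[THEN additive_subgroup.zero_closed] by simp
  then show "shift_letters f \<in> hecke_embedding ?n ?X"
    unfolding mem using coset_self[OF f] by (intro bexI) simp_all
  fix g assume "g \<in> hecke_embedding ?n ?X"
  then obtain h g' where hg: "h \<in> hecke_ideal ?n" "g' \<in> ?X" "g = h + shift_letters g'"
    unfolding mem by (elim bexE)
  obtain h' where h': "h' \<in> hecke_ideal (?n - 1)" "g' = h' + f"
    using hg(2) by (auto simp: a_r_coset_def')
  have g': "g' \<in> carrier (free_algebra (?n - 1))"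
    unfolding h'(2) by (rule free_carrier_add[OF hecke_ideal_carrier[OF h'(1)] f])
  have "free_action (shift_letters g') v = free_action (shift_letters f) v"
  proof (rule component_inj[OF keys_free_action[OF v] keys_free_action[OF v]])
    fix \<beta> assume \<beta>: "\<beta> \<in> B"
    have "free_action g' (component \<beta> v) = free_action f (component \<beta> v)"
      by (rule free_action_coset[OF _ keys_component]) (simp only: B_sum_list[OF \<beta>] hg(2))
    then show "component \<beta> (free_action (shift_letters g') v) =
        component \<beta> (free_action (shift_letters f) v)"
      by (simp only: component_free_action[OF \<beta> v g'] component_free_action[OF \<beta> v f])
  qed
  then show "free_action g v = free_action (shift_letters f) v"
    by (simp only: hg(3) free_action_linear hecke_ideal_annihilates[OF hg(1) v] add_0)
qed

lemma branching_rule: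
  "isomorphic_modules (hecke0 (sum_list \<alpha> - 1))
    (restrict_scalars (hecke_embedding (sum_list \<alpha>)) (\<^bold>S \<alpha>)) (direct_sum B \<^bold>S)"
proof (rule isomorphic_modules_transport)
  let ?R = "hecke0 (sum_list \<alpha> - 1)" and ?\<phi> = "\<lambda>v. \<lambda>\<beta>\<in>B. component \<beta> v"
  let ?M = "restrict_scalars (hecke_embedding (sum_list \<alpha>)) (\<^bold>S \<alpha>)"
  let ?N = "direct_sum B \<^bold>S"
  have M: "carrier ?M = {v. Poly_Mapping.keys v \<subseteq> srct \<alpha>}" "add ?M = (+)" "zero ?M = 0"
    "smult ?M = (\<lambda>X v. hecke_embedding (sum_list \<alpha>) X \<odot>\<^bsub>\<^bold>S \<alpha>\<^esub> v)"
    by (simp_all add: restrict_scalars_def)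
  have N: "carrier ?N = (\<Pi>\<^sub>E \<beta>\<in>B. {v. Poly_Mapping.keys v \<subseteq> srct \<beta>})"
    by (simp add: carrier_direct_sum[OF finite_node_removals])
  have in_N: "?\<phi> v \<in> carrier ?N" for v
    unfolding N by (rule restrict_PiE) (simp add: keys_component)
  show "left_module ?R ?N"
  proof (rule left_module_direct_sum[OF ring_hecke0 finite_node_removals])
    fix \<beta> assume "\<beta> \<in> B"
    from left_module_srct_module[of \<beta>] show "left_module ?R (\<^bold>S \<beta>)"
      by (simp only: B_sum_list[OF \<open>\<beta> \<in> B\<close>])
  qed
  show "abelian_group ?M"
  proof (rule abelian_groupI)
    fix u v assume "u \<in> carrier ?M" "v \<in> carrier ?M"
    then show "u \<oplus>\<^bsub>?M\<^esub> v \<in> carrier ?M"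
      using abelian_monoid.a_closed[OF abelian_group.axioms(1)[OF abelian_group_srct_module[of \<alpha>]], of u v]
      by (simp add: M)
  next
    fix v assume "v \<in> carrier ?M"
    then show "\<exists>u\<in>carrier ?M. u \<oplus>\<^bsub>?M\<^esub> v = \<zero>\<^bsub>?M\<^esub>"
      by (intro bexI[of _ "- v"]) (simp_all add: M)
  qed (simp_all add: M add.assoc add.commute)
  show closed: "X \<odot>\<^bsub>?M\<^esub> v \<in> carrier ?M" if X: "X \<in> carrier ?R" and "v \<in> carrier ?M" for X v
  proof -
    obtain f where f: "f \<in> carrier (free_algebra (sum_list \<alpha> - 1))"
      "X = hecke_ideal (sum_list \<alpha> - 1) +>\<^bsub>free_algebra (sum_list \<alpha> - 1)\<^esub> f"
      by (rule hecke0_cosetE[OF X])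
    have v: "Poly_Mapping.keys v \<subseteq> srct \<alpha>" using that(2) by (simp add: M)
    show ?thesis
      unfolding M f(2) restricted_smult[OF f(1) v] using keys_free_action[OF v] by simp
  qed
  show "?\<phi> \<in> module_hom ?R ?M ?N"
    unfolding module_hom_def mem_Collect_eq
  proof (intro conjI ballI)
    show "?\<phi> \<in> carrier ?M \<rightarrow> carrier ?N" by (rule Pi_I) (rule in_N)
    fix u v
    show "?\<phi> (u \<oplus>\<^bsub>?M\<^esub> v) = ?\<phi> u \<oplus>\<^bsub>?N\<^esub> ?\<phi> v"
      unfolding M direct_sum_simps
      by (rule restrict_ext) (simp add: complex_linear_add[OF complex_linear_component])
  next
    fix X v assume X: "X \<in> carrier ?R" and "v \<in> carrier ?M"
    then have v: "Poly_Mapping.keys v \<subseteq> srct \<alpha>" by (simp add: M)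
    obtain f where f: "f \<in> carrier (free_algebra (sum_list \<alpha> - 1))"
      "X = hecke_ideal (sum_list \<alpha> - 1) +>\<^bsub>free_algebra (sum_list \<alpha> - 1)\<^esub> f"
      by (rule hecke0_cosetE[OF X])
    show "?\<phi> (X \<odot>\<^bsub>?M\<^esub> v) = X \<odot>\<^bsub>?N\<^esub> ?\<phi> v"
      unfolding M direct_sum_simps f(2) restricted_smult[OF f(1) v]
    proof (rule restrict_ext)
      fix \<beta> assume \<beta>: "\<beta> \<in> B"
      \<comment> \<open>\<open>smult_coset\<close> speaks of cosets for the size of
        \<open>\<beta>\<close>. All removals have size \<open>sum_list \<alpha> - 1\<close>, so this
        is the given coset.\<close>
      have "(hecke_ideal (sum_list \<beta>) +>\<^bsub>free_algebra (sum_list \<beta>)\<^esub> f) \<odot>\<^bsub>\<^bold>S \<beta>\<^esub> component \<beta> v =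
          free_action f (component \<beta> v)"
        by (rule smult_coset[OF _ keys_component]) (simp only: B_sum_list[OF \<beta>] f(1))
      then show "component \<beta> (free_action (shift_letters f) v) =
          (hecke_ideal (sum_list \<alpha> - 1) +>\<^bsub>free_algebra (sum_list \<alpha> - 1)\<^esub> f) \<odot>\<^bsub>\<^bold>S \<beta>\<^esub>
            (\<lambda>\<beta>\<in>B. component \<beta> v) \<beta>"
        by (simp only: B_sum_list[OF \<beta>] restrict_apply' \<beta> component_free_action[OF \<beta> v f(1)])
    qed
  qed
  show "bij_betw ?\<phi> (carrier ?M) (carrier ?N)"
  proof (rule bij_betw_imageI)
    show "inj_on ?\<phi> (carrier ?M)"
    proof (rule inj_onI)
      fix u v assume "u \<in> carrier ?M" "v \<in> carrier ?M" and eq: "?\<phi> u = ?\<phi> v"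
      then have uv: "Poly_Mapping.keys u \<subseteq> srct \<alpha>" "Poly_Mapping.keys v \<subseteq> srct \<alpha>"
        by (simp_all only: M mem_Collect_eq)
      have "component \<beta> u = component \<beta> v" if "\<beta> \<in> B" for \<beta>
        using fun_cong[OF eq, of \<beta>] that by simp
      then show "u = v" by (rule component_inj[OF uv])
    qed
    show "?\<phi> ` carrier ?M = carrier ?N"
    proof (intro equalityI subsetI)
      fix g assume "g \<in> ?\<phi> ` carrier ?M"
      then show "g \<in> carrier ?N" by (elim imageE) (simp only: in_N)
    next
      fix g assume g: "g \<in> carrier ?N"
      have "Poly_Mapping.keys (g \<beta>) \<subseteq> srct \<beta>" if "\<beta> \<in> B" for \<beta>
        using PiE_mem[OF g[unfolded N] that] by simp
      then have "\<exists>v. Poly_Mapping.keys v \<subseteq> srct \<alpha> \<and> (\<forall>\<beta>\<in>B. component \<beta> v = g \<beta>)"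
        by (rule component_surj)
      then obtain v where v: "Poly_Mapping.keys v \<subseteq> srct \<alpha>"
        "\<forall>\<beta>\<in>B. component \<beta> v = g \<beta>"
        by (elim exE conjE)
      have "?\<phi> v = restrict g B" by (rule restrict_ext) (rule bspec[OF v(2)])
      also have "\<dots> = g" by (rule PiE_restrict[OF g[unfolded N]])
      finally have "g = ?\<phi> v" by (rule sym)
      moreover have "v \<in> carrier ?M" using v(1) by (simp add: M)
      ultimately show "g \<in> ?\<phi> ` carrier ?M" by (rule image_eqI)
    qed
  qed
qed

end

theorem corollary9p11:
  fixes \<alpha> :: "nat list" and n :: nat
  assumes "\<alpha> \<Turnstile> n" and "n \<ge> 1"
  shows "isomorphic_modules (hecke0 (n - 1))
           (restrict_scalars (hecke_embedding n) (\<^bold>S \<alpha>))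
           (direct_sum (node_removals \<alpha>) \<^bold>S)"
proof -
  have "branching \<alpha>" and n: "sum_list \<alpha> = n"
    using assms by (simp_all add: branching_def composition_of_def)
  from branching.branching_rule[OF this(1)] show ?thesis by (simp only: n)
qed

end
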